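(* Let $\Bbbk$ be a field of characteristic zero and let $n \geq 2$ be an integer. (1) If $\Bbbk$ is algebraically closed, an $n$-dimensional commutative $\Bbbk$-algebra $(\mathbb{A}, \circ)$ is isomorphic to the simplicial algebra $\mathbb{E}^{n}(\Bbbk)$ if and only if it is exact, has nondegenerate Killing form, and is projectively associative. (2) An $n$-dimensional commutative $\mathbb{R}$-algebra $(\mathbb{A}, \circ)$ is isomorphic to $\mathbb{E}^{n}(\mathbb{R})$ if and only if it is exact, has positive definite Killing form, and is projectively associative.
   Context: An algebra over a field $\Bbbk$ is a finite-dimensional $\Bbbk$-vector space with a $\Bbbk$-bilinear multiplication $\circ$, not assumed unital or associative. Write $L_\circ(x)y = x\circ y$. A commutative algebra is exact if $\operatorname{tr} L_\circ(x) = 0$ for all $x$. Its Killing form is $\tau_\circ(x,y) = \operatorname{tr} L_\circ(x)L_\circ(y)$. The associator is $[x,y,z] = (x\circ y)\circ z - x\circ(y\circ z)$. A commutative algebra is projectively associative if there is a symmetric bilinear form $c$ on $\mathbb{A}$ such that $[x,y,z] = c(y,z)x - c(x,y)z$ for all $x,y,z\in\mathbb{A}$. Simplicial algebra: for $\operatorname{char}\Bbbk = 0$ and $n\geq 2$, $\mathbb{E}^n(\Bbbk)$ is the quotient of the $(n+1)$-dimensional commutative algebra with basis $e_0,\dots,e_n$ and products $e_i\circ e_i = e_i$, $e_i\circ e_j = -\tfrac{1}{n-1}(e_i+e_j)$ for $i\neq j$, by its maximal ideal, which is the line spanned by $e_0+\dots+e_n$. Equivalently it is the $n$-dimensional commutative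 algebra spanned by $\gamma_0,\dots,\gamma_n$ with $\sum_{i=0}^n\gamma_i = 0$ (any $n$ of the $\gamma_i$ forming a basis), $\gamma_i\circ\gamma_i = \gamma_i$, and $\gamma_i\circ\gamma_j = -\tfrac{1}{n-1}(\gamma_i+\gamma_j)$ for $i\neq j$. *)

theory Defs
  imports "HOL-Analysis.Analysis"
begin

section \<open>Finite-dimensional algebras, not assumed unital or associative\<close>

definition bilinear_on ::
  "('k::field \<Rightarrow> 'a::ab_group_add \<Rightarrow> 'a) \<Rightarrow> ('k \<Rightarrow> 'b::ab_group_add \<Rightarrow> 'b) \<Rightarrow> ('a \<Rightarrow> 'a \<Rightarrow> 'b) \<Rightarrow> bool"
  where "bilinear_on s t f \<longleftrightarrow>
    (\<forall>x. Vector_Spaces.linear s t (\<lambda>y. f x y)) \<and> (\<forall>y. Vector_Spaces.linear s t (\<lambda>x. f x y))"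

text \<open>The basis \<open>extend_basis {}\<close> is chosen arbitrarily; \<open>trace_eq\<close> below shows that for
  linear maps the choice does not matter.\<close>
definition (in vector_space) trace :: "('b \<Rightarrow> 'b) \<Rightarrow> 'a"
  where "trace f = (\<Sum>b\<in>extend_basis {}. representation (extend_basis {}) (f b) b)"

locale fd_algebra = vector_space scale
  for scale :: "'k::field \<Rightarrow> 'a::ab_group_add \<Rightarrow> 'a" (infixr \<open>\<cdot>\<close> 75) +
  fixes mult :: "'a \<Rightarrow> 'a \<Rightarrow> 'a" (infixl \<open>\<odot>\<close> 70)
  assumes finite_dim: "\<exists>B. finite B \<and> span B = UNIV"
    and bilinear_mult: "bilinear_on scale scale mult"
begin

definition associator :: "'a \<Rightarrow> 'a \<Rightarrow> 'a \<Rightarrow> 'a"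
  where "associator x y z = (x \<odot> y) \<odot> z - x \<odot> (y \<odot> z)"

definition killing :: "'a \<Rightarrow> 'a \<Rightarrow> 'k"
  where "killing x y = trace (\<lambda>z. x \<odot> (y \<odot> z))"

definition exact :: bool
  where "exact \<longleftrightarrow> (\<forall>x. trace (\<lambda>y. x \<odot> y) = 0)"

definition nondegenerate_killing :: bool
  where "nondegenerate_killing \<longleftrightarrow> (\<forall>x. (\<forall>y. killing x y = 0) \<longrightarrow> x = 0)"

definition projectively_associative :: bool
  where "projectively_associative \<longleftrightarrow>
    (\<exists>c :: 'a \<Rightarrow> 'a \<Rightarrow> 'k. bilinear_on scale (*) c \<and> (\<forall>x y. c x y = c y x) \<and>
      (\<forall>x y z. associator x y z = c y z \<cdot> x - c x y \<cdot> z))"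

end

locale fd_comm_algebra = fd_algebra +
  assumes mult_commute: "mult x y = mult y x"

definition pos_def_killing :: "(real \<Rightarrow> 'a::ab_group_add \<Rightarrow> 'a) \<Rightarrow> ('a \<Rightarrow> 'a \<Rightarrow> 'a) \<Rightarrow> bool"
  where "pos_def_killing s m \<longleftrightarrow> (\<forall>x. x \<noteq> 0 \<longrightarrow> fd_algebra.killing s m x x > 0)"

definition algebra_isomorphic ::
  "('k::field \<Rightarrow> 'a::ab_group_add \<Rightarrow> 'a) \<Rightarrow> ('a \<Rightarrow> 'a \<Rightarrow> 'a) \<Rightarrow>
   ('k \<Rightarrow> 'b::ab_group_add \<Rightarrow> 'b) \<Rightarrow> ('b \<Rightarrow> 'b \<Rightarrow> 'b) \<Rightarrow> bool"
  where "algebra_isomorphic s m s' m' \<longleftrightarrow>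
    (\<exists>f. Vector_Spaces.linear s s' f \<and> bij f \<and> (\<forall>x y. f (m x y) = m' (f x) (f y)))"

lemma (in vector_space) trace_eq:
  assumes fd: "\<exists>S. finite S \<and> span S = UNIV"
    and B: "independent B" "span B = UNIV"
    and f: "Vector_Spaces.linear scale scale f"
  shows "trace f = (\<Sum>b\<in>B. representation B (f b) b)"
proof -
  interpret f: Vector_Spaces.linear scale scale f by (rule f)
  define C where "C = extend_basis {}"
  have C: "independent C" "span C = UNIV"
    unfolding C_def using independent_extend_basis[OF independent_empty] span_extend_basis[OF independent_empty]
    by auto
  obtain S where S: "finite S" "span S = UNIV" using fd by blast
  have fin: "finite B" "finite C"
    using independent_span_bound[OF S(1)] B C S by auto
  have exp: "(\<Sum>b\<in>D. scale (representation D v b) b) = v"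
    if "independent D" "span D = UNIV" "finite D" for D v
    using sum_representation_eq[OF that(1) _ that(3), of v] that by simp
  have rsum: "representation D (\<Sum>i\<in>I. scale (g i) (h i)) d = (\<Sum>i\<in>I. g i * representation D (h i) d)"
    if "independent D" "span D = UNIV" for D I d and g :: "'b \<Rightarrow> 'a" and h
    using that by (simp add: representation_sum representation_scale)
  have "trace f = (\<Sum>c\<in>C. representation C (f c) c)"
    by (simp add: trace_def C_def)
  also have "\<dots> = (\<Sum>c\<in>C. \<Sum>b\<in>B. representation B (f c) b * representation C b c)"
    by (subst exp[OF B fin(1), symmetric], subst rsum[OF C]) simp
  also have "\<dots> = (\<Sum>b\<in>B. \<Sum>c\<in>C. representation C b c * representation B (f c) b)"
    by (subst sum.swap) (simp add: mult.commute)
  also have "\<dots> = (\<Sum>b\<in>B. representation B (f b) b)"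
  proof (rule sum.cong[OF refl])
    fix b assume "b \<in> B"
    have "f b = f (\<Sum>c\<in>C. scale (representation C b c) c)" by (simp add: exp[OF C fin(2)])
    also have "\<dots> = (\<Sum>c\<in>C. scale (representation C b c) (f c))" by (simp add: f.sum f.scale)
    finally show "(\<Sum>c\<in>C. representation C b c * representation B (f c) b) = representation B (f b) b"
      by (simp add: rsum[OF B])
  qed
  finally show ?thesis .
qed


section \<open>The simplicial algebra\<close>

text \<open>The basis \<open>e\<^sub>0, \<dots>, e\<^sub>n\<close> of the \<open>(n+1)\<close>-dimensional algebra is indexed by \<open>'n option\<close>
  with \<open>n = CARD('n)\<close>.\<close>
definition simp_cover_times :: "'k::field ^ 'n::finite option \<Rightarrow> 'k ^ 'n option \<Rightarrow> 'k ^ 'n option"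
  where "simp_cover_times x y =
    (\<Sum>i\<in>UNIV. \<Sum>j\<in>UNIV. (x $ i * y $ j) *s
      (if i = j then axis i 1 else - (1 / (of_nat CARD('n) - 1)) *s (axis i 1 + axis j 1)))"

definition simp_rel :: "'k::field ^ 'n::finite option \<Rightarrow> 'k ^ 'n option \<Rightarrow> bool"
  where "simp_rel x y \<longleftrightarrow> (\<exists>c. x - y = c *s (\<Sum>i\<in>UNIV. axis i 1))"

lemma sum_axis: "(\<Sum>i\<in>UNIV. axis i 1 :: 'k::field ^ 'm::finite) = (\<chi> i. 1)"
  by (simp add: vec_eq_iff axis_def)

lemma simp_rel_iff: "simp_rel x y \<longleftrightarrow> (\<exists>c. \<forall>i. x $ i = y $ i + c)"
  by (simp add: simp_rel_def sum_axis vec_eq_iff algebra_simps)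

quotient_type (overloaded) ('k, 'n) simplicial = "'k::field ^ 'n::finite option" / simp_rel
proof (rule equivpI)
  show "reflp (simp_rel :: 'k ^ 'n option \<Rightarrow> _)"
    by (auto simp: reflp_def simp_rel_iff intro!: exI[of _ 0])
  show "symp (simp_rel :: 'k ^ 'n option \<Rightarrow> _)"
    unfolding symp_def simp_rel_iff by (metis add_diff_cancel diff_add_cancel diff_conv_add_uminus)
  show "transp (simp_rel :: 'k ^ 'n option \<Rightarrow> _)"
    unfolding transp_def simp_rel_iff by (metis add.assoc)
qed

instantiation simplicial :: (field, finite) ab_group_add
begin

lift_definition zero_simplicial :: "('a, 'b) simplicial" is 0 .

lift_definition plus_simplicial :: "('a, 'b) simplicial \<Rightarrow> ('a, 'b) simplicial \<Rightarrow> ('a, 'b) simplicial"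
  is "(+)"
proof -
  fix a b c d :: "'a ^ 'b option" assume "simp_rel a b" "simp_rel c d"
  then obtain r s where "\<forall>i. a $ i = b $ i + r" "\<forall>i. c $ i = d $ i + s"
    unfolding simp_rel_iff by blast
  then show "simp_rel (a + c) (b + d)"
    unfolding simp_rel_iff by (intro exI[of _ "r + s"]) (simp add: algebra_simps)
qed

lift_definition uminus_simplicial :: "('a, 'b) simplicial \<Rightarrow> ('a, 'b) simplicial" is uminus
proof -
  fix a b :: "'a ^ 'b option" assume "simp_rel a b"
  then obtain r where "\<forall>i. a $ i = b $ i + r" unfolding simp_rel_iff by blast
  then show "simp_rel (- a) (- b)"
    unfolding simp_rel_iff by (intro exI[of _ "- r"]) (simp add: algebra_simps)
qed

definition minus_simplicial :: "('a, 'b) simplicial \<Rightarrow> ('a, 'b) simplicial \<Rightarrow> ('a, 'b) simplicial"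
  where "minus_simplicial x y = x + (- y)"

instance
proof
  fix a b c :: "('a, 'b) simplicial"
  have eq: "simp_rel x y" if "x = y" for x y :: "'a ^ 'b option"
    using that by (auto simp: simp_rel_iff intro!: exI[of _ 0])
  show "a + b + c = a + (b + c)" by transfer (rule eq, simp)
  show "a + b = b + a" by transfer (rule eq, simp)
  show "0 + a = a" by transfer (rule eq, simp)
  show "- a + a = 0" by transfer (rule eq, simp)
  show "a - b = a + - b" by (simp add: minus_simplicial_def)
qed

end

lift_definition simp_scale :: "'k::field \<Rightarrow> ('k, 'n::finite) simplicial \<Rightarrow> ('k, 'n) simplicial"
  is "(*s)"
proof -
  fix t :: 'k and a b :: "'k ^ 'n option" assume "simp_rel a b"
  then obtain r where "\<forall>i. a $ i = b $ i + r" unfolding simp_rel_iff by blast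
  then show "simp_rel (t *s a) (t *s b)"
    unfolding simp_rel_iff by (intro exI[of _ "t * r"]) (simp add: algebra_simps)
qed

text \<open>The line \<open>\<langle>e\<^sub>0 + \<dots> + e\<^sub>n\<rangle>\<close> is not an ideal when \<open>n = 1\<close>, so the induced product is
  written with representatives; \<open>simp_times_abs\<close> shows that it is well defined for \<open>n \<ge> 2\<close>.\<close>
definition simp_times :: "('k::field, 'n::finite) simplicial \<Rightarrow> ('k, 'n) simplicial \<Rightarrow> ('k, 'n) simplicial"
  where "simp_times x y =
    abs_simplicial (simp_cover_times (rep_simplicial x) (rep_simplicial y))"

lemma simp_cover_times_nth:
  fixes x y :: "'k::field ^ 'n::finite option"
  defines "r \<equiv> - (1 / (of_nat CARD('n) - 1)) :: 'k"
  shows "simp_cover_times x y $ k =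
    x $ k * y $ k + r * (x $ k * (sum (($) y) UNIV - y $ k) + (sum (($) x) UNIV - x $ k) * y $ k)"
proof -
  define d :: "'n option \<Rightarrow> 'n option \<Rightarrow> 'k" where "d i j = (if i = j then 1 else 0)" for i j
  have "simp_cover_times x y $ k =
     (\<Sum>i\<in>UNIV. \<Sum>j\<in>UNIV. (x $ i * y $ j) *
        (r * (d k i + d k j) + (1 - 2 * r) * (d i j * d k i)))"
    unfolding simp_cover_times_def r_def[symmetric] sum_component
    by (intro sum.cong refl) (auto simp: d_def axis_def)
  also have "\<dots> = r * (\<Sum>i\<in>UNIV. d k i * (x $ i * (\<Sum>j\<in>UNIV. y $ j)))
      + r * (\<Sum>i\<in>UNIV. x $ i * (\<Sum>j\<in>UNIV. d k j * y $ j))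
      + (1 - 2 * r) * (\<Sum>i\<in>UNIV. d k i * (x $ i * (\<Sum>j\<in>UNIV. d i j * y $ j)))"
    unfolding sum_distrib_left sum.distrib[symmetric]
    by (intro sum.cong refl) (simp add: algebra_simps)
  also have "\<dots> = r * (x $ k * sum (($) y) UNIV) + r * (sum (($) x) UNIV * y $ k)
      + (1 - 2 * r) * (x $ k * y $ k)"
  proof -
    have s: "(\<Sum>i\<in>UNIV. d l i * g i) = g l" for l and g :: "'n option \<Rightarrow> 'k"
    proof -
      have "(\<Sum>i\<in>UNIV. d l i * g i) = (\<Sum>i\<in>UNIV. if l = i then g i else 0)"
        by (intro sum.cong) (auto simp: d_def)
      then show ?thesis by simp
    qed
    show ?thesis by (simp add: s sum_distrib_right)
  qed
  finally show ?thesis by (simp add: algebra_simps)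
qed

lemma simp_cover_times_commute: "simp_cover_times x y = simp_cover_times y x"
  by (simp add: vec_eq_iff simp_cover_times_nth algebra_simps)

lemma simp_cover_times_add:
  "simp_cover_times x (y + z) = simp_cover_times x y + simp_cover_times x z"
  by (simp add: vec_eq_iff simp_cover_times_nth sum.distrib algebra_simps)

lemma simp_cover_times_scale:
  "simp_cover_times x (t *s y) = t *s simp_cover_times x y"
proof -
  have "(\<Sum>i\<in>UNIV. t * y $ i) = t * (\<Sum>i\<in>UNIV. y $ i)" by (simp add: sum_distrib_left)
  then show ?thesis by (simp add: vec_eq_iff simp_cover_times_nth algebra_simps)
qed

lemma simp_cover_times_respects:
  fixes x y x' y' :: "'k::field_char_0 ^ 'n::finite option"
  assumes n: "CARD('n) \<ge> 2" and "simp_rel x x'" "simp_rel y y'"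
  shows "simp_rel (simp_cover_times x y) (simp_cover_times x' y')"
proof -
  have *: "simp_rel (simp_cover_times x y) (simp_cover_times x y')"
    if "simp_rel y y'" for x y y' :: "'k ^ 'n option"
  proof -
    from that obtain c where "\<forall>i. y $ i = y' $ i + c" unfolding simp_rel_iff by blast
    then have c: "y $ i = y' $ i + c" for i by blast
    define m :: 'k where "m = of_nat CARD('n)"
    have m: "m - 1 \<noteq> 0" using n unfolding m_def
      by (metis Suc_1 not_less_eq_eq order_refl of_nat_1 of_nat_eq_iff right_minus_eq)
    have s: "sum (($) y) UNIV = sum (($) y') UNIV + (m + 1) * c"
      by (simp add: c sum.distrib m_def card_UNIV_option algebra_simps)
    define r where "r = - (1 / (m - 1))"
    have mr: "m * r = r - 1" using m by (simp add: r_def field_simps)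
    have "simp_cover_times x y $ k = simp_cover_times x y' $ k + r * (sum (($) x) UNIV * c)" for k
    proof -
      have "simp_cover_times x y $ k - simp_cover_times x y' $ k =
          x $ k * c + (m * r) * (x $ k * c) + r * ((sum (($) x) UNIV - x $ k) * c)"
        unfolding simp_cover_times_nth s c[of k] m_def[symmetric] r_def[symmetric]
        by (simp add: algebra_simps)
      then show ?thesis unfolding mr by (simp add: algebra_simps)
    qed
    then show ?thesis unfolding simp_rel_iff by blast
  qed
  have "simp_rel (simp_cover_times x y) (simp_cover_times x y')" by (rule *[OF assms(3)])
  moreover have "simp_rel (simp_cover_times x y') (simp_cover_times x' y')"
    using *[OF assms(2), of y'] by (simp add: simp_cover_times_commute)
  ultimately show ?thesis
    using simplicial.abs_eq_iff by metis
qed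

lemma simp_times_abs:
  fixes x y :: "'k::field_char_0 ^ 'n::finite option"
  assumes "CARD('n) \<ge> 2"
  shows "simp_times (abs_simplicial x) (abs_simplicial y) = abs_simplicial (simp_cover_times x y)"
proof -
  have "simp_rel (rep_simplicial (abs_simplicial z)) z" for z :: "'k ^ 'n option"
    using simplicial.abs_eq_iff Quotient3_simplicial Quotient3_abs_rep by metis
  then show ?thesis unfolding simp_times_def simplicial.abs_eq_iff
    by (intro simp_cover_times_respects[OF assms])
qed

interpretation simplicial: vector_space
  "simp_scale :: 'k::field \<Rightarrow> ('k, 'n::finite) simplicial \<Rightarrow> ('k, 'n) simplicial"
proof
  have eq: "simp_rel x y" if "x = y" for x y :: "'k ^ 'n option"
    using that by (auto simp: simp_rel_iff intro!: exI[of _ 0])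
  fix a b :: 'k and x y :: "('k, 'n) simplicial"
  show "simp_scale a (x + y) = simp_scale a x + simp_scale a y"
    by transfer (rule eq, simp add: vec_eq_iff algebra_simps)
  show "simp_scale (a + b) x = simp_scale a x + simp_scale b x"
    by transfer (rule eq, simp add: vec_eq_iff algebra_simps)
  show "simp_scale a (simp_scale b x) = simp_scale (a * b) x"
    by transfer (rule eq, simp add: vec_eq_iff algebra_simps)
  show "simp_scale 1 x = x"
    by transfer (rule eq, simp)
qed

definition simp_gamma :: "'n::finite option \<Rightarrow> ('k::field, 'n) simplicial"
  where "simp_gamma i = abs_simplicial (axis i 1)"

lemma abs_simplicial_sum:
  "abs_simplicial (sum f A) = (\<Sum>a\<in>A. abs_simplicial (f a))"
  by (induction A rule: infinite_finite_induct)
    (simp_all add: zero_simplicial.abs_eq[symmetric] plus_simplicial.abs_eq[symmetric])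

lemma abs_simplicial_eq:
  "abs_simplicial x = (\<Sum>i\<in>UNIV. simp_scale (x $ i) (simp_gamma i))"
proof -
  have "x = (\<Sum>i\<in>UNIV. (x $ i) *s axis i 1)"
    by (simp add: basis_expansion)
  then have "abs_simplicial x = abs_simplicial (\<Sum>i\<in>UNIV. (x $ i) *s axis i 1)" by simp
  then show ?thesis by (simp add: abs_simplicial_sum simp_gamma_def simp_scale.abs_eq)
qed

lemma sum_simp_gamma: "(\<Sum>i\<in>UNIV. simp_gamma i) = (0 :: ('k::field, 'n::finite) simplicial)"
proof -
  have "(\<Sum>i\<in>UNIV. simp_gamma i) = abs_simplicial (\<Sum>i\<in>UNIV. axis i 1 :: 'k ^ 'n option)"
    by (simp add: abs_simplicial_sum simp_gamma_def)
  also have "\<dots> = 0"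
    unfolding zero_simplicial_def simplicial.abs_eq_iff
    by (auto simp: simp_rel_iff sum_axis)
  finally show ?thesis .
qed

lemma simp_times_gamma:
  assumes "CARD('n::finite) \<ge> 2"
  shows "simp_times (simp_gamma i) (simp_gamma j :: ('k::field_char_0, 'n) simplicial) =
    (if i = j then simp_gamma i
     else simp_scale (- (1 / (of_nat CARD('n) - 1))) (simp_gamma i + simp_gamma j))"
proof -
  have "sum (($) (axis l 1 :: 'k ^ 'n option)) UNIV = 1" for l
    by (simp add: axis_def)
  then have "simp_cover_times (axis i 1) (axis j 1 :: 'k ^ 'n option) =
     (if i = j then axis i 1 else (- (1 / (of_nat CARD('n) - 1))) *s (axis i 1 + axis j 1))"
    by (auto simp: vec_eq_iff simp_cover_times_nth) (auto simp: axis_def)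
  then show ?thesis
    by (simp add: simp_gamma_def simp_times_abs[OF assms] simp_scale.abs_eq plus_simplicial.abs_eq)
qed

lemma span_simp_gamma:
  "simplicial.span (range (\<lambda>i. simp_gamma (Some i))) = (UNIV :: ('k::field, 'n::finite) simplicial set)"
proof -
  let ?S = "simplicial.span (range (\<lambda>i. simp_gamma (Some i) :: ('k, 'n) simplicial))"
  have some: "simp_gamma (Some i) \<in> ?S" for i
    by (rule simplicial.span_base) simp
  have "(\<Sum>i\<in>UNIV. simp_gamma i) = simp_gamma None + (\<Sum>i\<in>UNIV. simp_gamma (Some i) :: ('k, 'n) simplicial)"
    by (simp add: UNIV_option_conv sum.reindex)
  then have "simp_gamma None + (\<Sum>i\<in>UNIV. simp_gamma (Some i) :: ('k, 'n) simplicial) = 0"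
    unfolding sum_simp_gamma by (rule sym)
  then have eq: "simp_gamma None = - (\<Sum>i\<in>UNIV. simp_gamma (Some i) :: ('k, 'n) simplicial)"
    by (rule eq_neg_iff_add_eq_0[THEN iffD2])
  have none: "simp_gamma None \<in> ?S"
    unfolding eq by (intro simplicial.span_neg simplicial.span_sum some)
  have "simp_gamma i \<in> ?S" for i using some none by (cases i) auto
  then have abs: "abs_simplicial x \<in> ?S" for x
    unfolding abs_simplicial_eq by (intro simplicial.span_sum simplicial.span_scale)
  have "z \<in> ?S" for z
    by (induction z) (rule abs)
  then show ?thesis by (rule UNIV_eq_I[symmetric])
qed

lemma simp_gamma_lincomb_eq_0:
  fixes u :: "'n::finite \<Rightarrow> 'k::field"
  assumes "(\<Sum>i\<in>UNIV. simp_scale (u i) (simp_gamma (Some i))) = 0"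
  shows "u i = 0"
proof -
  define x :: "'k ^ 'n option" where "x = (\<chi> i. case i of None \<Rightarrow> 0 | Some j \<Rightarrow> u j)"
  have "abs_simplicial x = 0"
    unfolding abs_simplicial_eq using assms
    by (simp add: UNIV_option_conv sum.reindex x_def)
  then have "simp_rel x 0"
    unfolding zero_simplicial_def by (simp add: simplicial.abs_eq_iff)
  then obtain c where c: "\<forall>i. x $ i = 0 $ i + c" unfolding simp_rel_iff by blast
  from spec[OF c, of None] spec[OF c, of "Some i"] show ?thesis by (simp add: x_def)
qed

lemma inj_simp_gamma:
  "inj (\<lambda>i. simp_gamma (Some i) :: ('k::field, 'n::finite) simplicial)"
proof (rule injI, rule ccontr)
  fix i j :: 'n assume eq: "simp_gamma (Some i) = (simp_gamma (Some j) :: ('k, 'n) simplicial)" and ne: "i \<noteq> j"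
  define u :: "'n \<Rightarrow> 'k" where "u l = (if l = i then 1 else if l = j then - 1 else 0)" for l
  have "(\<Sum>l\<in>UNIV. simp_scale (u l) (simp_gamma (Some l))) =
      (\<Sum>l\<in>{i, j}. simp_scale (u l) (simp_gamma (Some l)))"
    by (rule sum.mono_neutral_right) (auto simp: u_def)
  also have "\<dots> = 0" using ne eq by (simp add: u_def)
  finally have "u i = 0" by (rule simp_gamma_lincomb_eq_0)
  then show False by (simp add: u_def)
qed

lemma independent_simp_gamma:
  "simplicial.independent (range (\<lambda>i. simp_gamma (Some i) :: ('k::field, 'n::finite) simplicial))"
proof (rule simplicial.independent_if_scalars_zero)
  fix f :: "('k, 'n) simplicial \<Rightarrow> 'k" and x :: "('k, 'n) simplicial"
  assume "(\<Sum>x\<in>range (\<lambda>i. simp_gamma (Some i)). simp_scale (f x) x) = 0"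
    and x: "x \<in> range (\<lambda>i. simp_gamma (Some i))"
  then have "(\<Sum>i\<in>UNIV. simp_scale (f (simp_gamma (Some i))) (simp_gamma (Some i))) = 0"
    by (simp add: sum.reindex[OF inj_simp_gamma])
  then show "f x = 0" using x simp_gamma_lincomb_eq_0[where u = "\<lambda>i. f (simp_gamma (Some i))"] by blast
qed simp

lemma dim_simplicial:
  "simplicial.dim (UNIV :: ('k::field, 'n::finite) simplicial set) = CARD('n)"
  using simplicial.dim_eq_card[of "range (\<lambda>i. simp_gamma (Some i))" UNIV]
  by (simp add: independent_simp_gamma span_simp_gamma card_image[OF inj_simp_gamma])

lemma fd_comm_algebra_simplicial:
  assumes n: "CARD('n::finite) \<ge> 2"
  shows "fd_comm_algebra simp_scale
    (simp_times :: ('k::field_char_0, 'n) simplicial \<Rightarrow> ('k, 'n) simplicial \<Rightarrow> ('k, 'n) simplicial)"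
proof -
  let ?t = "simp_times :: ('k, 'n) simplicial \<Rightarrow> ('k, 'n) simplicial \<Rightarrow> ('k, 'n) simplicial"
  have comm: "?t x y = ?t y x" for x y
    by (simp add: simp_times_def simp_cover_times_commute)
  have add: "?t x (y + z) = ?t x y + ?t x z" for x y z
    by (induction x, induction y, induction z)
      (simp add: simp_times_abs[OF n] plus_simplicial.abs_eq simp_cover_times_add)
  have scale: "?t x (simp_scale a y) = simp_scale a (?t x y)" for x y a
    by (induction x, induction y)
      (simp add: simp_times_abs[OF n] simp_scale.abs_eq simp_cover_times_scale)
  have lin: "Vector_Spaces.linear simp_scale simp_scale (\<lambda>y. ?t x y)" for x
    by (intro Vector_Spaces.linear_iff[THEN iffD2] conjI allI add scale simplicial.vector_space_axioms)
  have lin': "Vector_Spaces.linear simp_scale simp_scale (\<lambda>x. ?t x y)" for y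
  proof -
    have "(\<lambda>x. ?t x y) = ?t y" by (rule ext) (rule comm)
    then show ?thesis using lin[of y] by simp
  qed
  have fin: "\<exists>B :: ('k, 'n) simplicial set. finite B \<and> simplicial.span B = UNIV"
    by (rule exI[of _ "range (\<lambda>i. simp_gamma (Some i))"]) (simp add: span_simp_gamma)
  show ?thesis
    apply unfold_locales
    subgoal by (rule fin)
    subgoal unfolding bilinear_on_def using lin lin' by blast
    subgoal by (rule comm)
    done
qed

end

theory Submission
  imports Defs "HOL-Computational_Algebra.Fundamental_Theorem_Algebra"
begin

text \<open>Let \<open>A\<close> be exact, projectively associative with form \<open>c\<close>, and of dimension \<open>n \<ge> 2\<close>. Taking traces in
  the formula for the associator shows that the Killing form is \<open>(n - 1) c\<close>, and the general
  identity between associators of four elements shows that \<open>c\<close> is invariant,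
  \<open>c (x y) z = c x (y z)\<close>. The key point is that the vector space \<open>A \<times> k\<close> with the product
  \<open>(x, a) (y, b) = (x y + a y + b x, c x y + a b)\<close> is then a commutative and associative algebra with
  unit \<open>(0, 1)\<close>: the term \<open>c x y\<close> compensates the associator of \<open>A\<close>.

  When the Killing form is nondegenerate, this unitization has no one-dimensional ideal of square
  zero (\<open>unitization_reduced\<close>). When moreover multiplication operators have eigenvectors in
  nonzero ideals, it is a product of \<open>n + 1\<close> copies of the ground field
  (\<open>orthogonal_idempotent_basis\<close>). Eigenvectors exist over an algebraically closed field, and over the
  reals if the Killing form is positive definite, since then the multiplication operators are
  self-adjoint for a positive definite form.

  Let \<open>(x\<^sub>i, a\<^sub>i)\<close>, \<open>0 \<le> i \<le> n\<close>, be the primitive idempotents. The \<open>x\<^sub>i\<close> add up to \<open>0\<close>, any \<open>n\<close> of them form a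
  basis of \<open>A\<close>, and the products of the idempotents give
  \<open>x\<^sub>i x\<^sub>i = (1 - 2 a\<^sub>i) x\<^sub>i\<close> and \<open>x\<^sub>i x\<^sub>j = - a\<^sub>i x\<^sub>j - a\<^sub>j x\<^sub>i\<close>. In such a basis, multiplication by \<open>x\<^sub>i\<close> has trace
  \<open>1 - (n + 1) a\<^sub>i\<close>, so that \<open>a\<^sub>i = 1 / (n + 1)\<close> by exactness. Therefore the vectors
  \<open>\<gamma>\<^sub>i = (n + 1) / (n - 1) x\<^sub>i\<close> multiply as in the simplicial algebra.

  Conversely, in the coordinates of \<open>\<gamma>\<^sub>1, \<dots>, \<gamma>\<^sub>n\<close> the product of the simplicial algebra is a perturbation
  of the pointwise product by the sum of the coordinates (\<open>coord_mult\<close>). This makes exactness and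
  projective associativity a direct computation, and gives \<open>c\<close>, and with it the Killing form, as an
  explicit quadratic form, nondegenerate in general and positive definite over the reals.\<close>

section \<open>Multiplication and traces in coordinates\<close>

context fd_algebra
begin

lemma linear_mult_left: "Vector_Spaces.linear scale scale (\<lambda>y. x \<odot> y)"
  and linear_mult_right: "Vector_Spaces.linear scale scale (\<lambda>x. x \<odot> y)"
  using bilinear_mult by (auto simp: bilinear_on_def)

lemma mult_add_right: "x \<odot> (y + z) = x \<odot> y + x \<odot> z"
  and mult_scale_right: "x \<odot> (t \<cdot> y) = t \<cdot> (x \<odot> y)"
  using linear_mult_left[of x] by (auto simp: Vector_Spaces.linear_iff)

lemma mult_add_left: "(x + y) \<odot> z = x \<odot> z + y \<odot> z"
  and mult_scale_left: "(t \<cdot> x) \<odot> z = t \<cdot> (x \<odot> z)"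
  using linear_mult_right[of z] by (auto simp: Vector_Spaces.linear_iff)

lemma mult_zero_right [simp]: "x \<odot> 0 = 0"
  and mult_zero_left [simp]: "0 \<odot> x = 0"
  using mult_scale_right[of x 0 0] mult_scale_left[of 0 0 x] by auto

lemma mult_sum_right: "x \<odot> sum f I = (\<Sum>i\<in>I. x \<odot> f i)"
  and mult_sum_left: "sum f I \<odot> x = (\<Sum>i\<in>I. f i \<odot> x)"
  by (induction I rule: infinite_finite_induct) (auto simp: mult_add_right mult_add_left)

lemma mult_diff_right: "x \<odot> (y - z) = x \<odot> y - x \<odot> z"
  and mult_diff_left: "(x - y) \<odot> z = x \<odot> z - y \<odot> z"
  using mult_add_right[of x "y - z" z] mult_add_left[of "x - y" y z] by auto

lemma standard_basis:
  "independent (extend_basis {})" "span (extend_basis {}) = UNIV" "finite (extend_basis {})"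
proof -
  show C: "independent (extend_basis {})" "span (extend_basis {}) = UNIV"
    using independent_extend_basis[OF independent_empty] span_extend_basis[OF independent_empty]
    by auto
  obtain S where S: "finite S" "span S = UNIV" using finite_dim by blast
  then show "finite (extend_basis {})"
    using independent_span_bound[OF S(1) C(1)] by auto
qed

lemma finite_dimensional: "\<exists>D. finite_dimensional_vector_space scale D"
proof -
  have "finite_dimensional_vector_space scale (extend_basis {})"
    using standard_basis by unfold_locales auto
  then show ?thesis by blast
qed

lemma finite_independent: "independent B \<Longrightarrow> finite B"
  using finite_dimensional finite_dimensional_vector_space.finiteI_independent by blast

lemma card_eq_dim_UNIV: "independent B \<Longrightarrow> span B = UNIV \<Longrightarrow> card B = dim UNIV"
  by (intro basis_card_eq_dim) auto

lemma sum_coordinates: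
  "independent B \<Longrightarrow> span B = UNIV \<Longrightarrow> (\<Sum>b\<in>B. representation B x b \<cdot> b) = x"
  by (rule sum_representation_eq) (auto simp: finite_independent)

lemma trace_add: "trace (\<lambda>x. f x + g x) = trace f + trace g"
  by (simp add: trace_def representation_add standard_basis sum.distrib)

lemma trace_diff: "trace (\<lambda>x. f x - g x) = trace f - trace g"
  by (simp add: trace_def representation_diff standard_basis sum_subtractf)

lemma trace_scale: "trace (\<lambda>x. t \<cdot> f x) = t * trace f"
  by (simp add: trace_def representation_scale standard_basis sum_distrib_left)

lemma trace_id: "trace (\<lambda>x. x) = of_nat (dim UNIV)"
  using card_eq_dim_UNIV[OF standard_basis(1,2)]
  by (simp add: trace_def representation_basis standard_basis)

lemma trace_rank_one:
  assumes "Vector_Spaces.linear scale (*) \<phi>"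
  shows "trace (\<lambda>x. \<phi> x \<cdot> z) = \<phi> z"
proof -
  interpret \<phi>: Vector_Spaces.linear scale "(*)" \<phi> by (rule assms)
  let ?C = "extend_basis {}"
  have "\<phi> z = \<phi> (\<Sum>b\<in>?C. representation ?C z b \<cdot> b)"
    by (simp add: sum_coordinates standard_basis)
  also have "\<dots> = (\<Sum>b\<in>?C. representation ?C z b * \<phi> b)"
    by (simp add: \<phi>.sum \<phi>.scale)
  finally show ?thesis
    by (simp add: trace_def representation_scale standard_basis mult.commute)
qed

end

section \<open>Simplicial frames\<close>

text \<open>The model is the set of the classes \<open>\<gamma>\<^sub>1, \<dots>, \<gamma>\<^sub>n\<close> in the simplicial algebra, with
  \<open>\<gamma>\<^sub>0 = - (\<gamma>\<^sub>1 + \<dots> + \<gamma>\<^sub>n)\<close> left out, so that the set is a basis. Being isomorphic to the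
  simplicial algebra thereby becomes an existence statement inside the given algebra.\<close>
definition (in fd_algebra) simplicial_frame :: "'a set \<Rightarrow> bool"
  where "simplicial_frame B \<longleftrightarrow> independent B \<and> span B = UNIV \<and>
    (\<forall>b\<in>B. \<forall>c\<in>B. b \<odot> c = (if b = c then b else - (1 / (of_nat (card B) - 1)) \<cdot> (b + c)))"

text \<open>A frame determines the whole multiplication table from its cardinality, so the linear map
  that matches two frames bijectively is multiplicative on a basis, hence everywhere.\<close>
lemma algebra_isomorphic_if_frames:
  assumes "fd_algebra s m" "fd_algebra s' m'"
    and B: "fd_algebra.simplicial_frame s m B" and C: "fd_algebra.simplicial_frame s' m' C"
    and card: "card B = card C"
  shows "algebra_isomorphic s m s' m'"
proof -
  interpret A: fd_algebra s m by fact
  interpret A': fd_algebra s' m' by fact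
  interpret vector_space_pair s s' by unfold_locales
  note Bs = B[unfolded A.simplicial_frame_def] and Cs = C[unfolded A'.simplicial_frame_def]
  have dims: "card B = A.dim UNIV" "card C = A'.dim UNIV"
    using Bs Cs by (auto intro!: A.card_eq_dim_UNIV A'.card_eq_dim_UNIV)
  obtain f where lin: "Vector_Spaces.linear s s' f" and fB: "f ` B = C"
    and surj: "f ` UNIV = UNIV" and inj: "inj f"
    using finite_basis_to_basis_subspace_isomorphism[of UNIV UNIV B C] dims card Bs Cs
      A.finite_independent A'.finite_independent by auto
  interpret f: Vector_Spaces.linear s s' f by (rule lin)
  have on_frame: "f (m b c) = m' (f b) (f c)" if "b \<in> B" "c \<in> B" for b c
  proof -
    have "f b \<in> C" "f c \<in> C" "f b = f c \<longleftrightarrow> b = c" using that fB injD[OF inj] by auto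
    then show ?thesis using that Bs Cs
      by (simp only: card f.scale f.add if_distrib[of f] cong: if_cong)
  qed
  have lin_f: "Vector_Spaces.linear s s' (\<lambda>y. f (g y))" if "Vector_Spaces.linear s s g" for g
    using Vector_Spaces.linear_compose[OF that lin] by (simp add: o_def)
  have lin_m': "Vector_Spaces.linear s s' (\<lambda>y. m' z (f y))"
    "Vector_Spaces.linear s s' (\<lambda>y. m' (f y) z)" for z
    using Vector_Spaces.linear_compose[OF lin A'.linear_mult_left]
      Vector_Spaces.linear_compose[OF lin A'.linear_mult_right] by (auto simp: o_def)
  have half: "f (m b y) = m' (f b) (f y)" if "b \<in> B" for b y
  proof (rule linear_eq_on[OF lin_f[OF A.linear_mult_left] lin_m'(1)])
    show "y \<in> A.span B" using Bs by auto
  qed (rule on_frame[OF that])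
  have "f (m x y) = m' (f x) (f y)" for x y
  proof (rule linear_eq_on[OF lin_f[OF A.linear_mult_right] lin_m'(2)])
    show "x \<in> A.span B" using Bs by auto
  qed (rule half)
  then show ?thesis unfolding algebra_isomorphic_def
    using lin inj surj by (auto simp: bij_def)
qed

lemma simplicial_frame_image:
  assumes "fd_algebra s m" "fd_algebra s' m'"
    and lin: "Vector_Spaces.linear s s' f" and bij: "bij f"
    and mult: "\<And>x y. f (m x y) = m' (f x) (f y)"
    and B: "fd_algebra.simplicial_frame s m B"
  shows "fd_algebra.simplicial_frame s' m' (f ` B)"
proof -
  interpret A: fd_algebra s m by fact
  interpret A': fd_algebra s' m' by fact
  interpret f: Vector_Spaces.linear s s' f by (rule lin)
  note Bs = B[unfolded A.simplicial_frame_def]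
  have inj: "inj f" and surj: "surj f" using bij by (auto simp: bij_def)
  have card: "card (f ` B) = card B" by (rule card_image) (rule inj_on_subset[OF inj], simp)
  have "A'.span (f ` B) = UNIV" using Bs surj by (simp add: f.span_image)
  moreover have "A'.independent (f ` B)" using Bs inj
    by (intro f.independent_injective_image) (auto intro: inj_on_subset)
  moreover have "m' (f b) (f c) = (if f b = f c then f b else
      s' (- (1 / (of_nat (card B) - 1))) (f b + f c))" if "b \<in> B" "c \<in> B" for b c
    using that Bs
    by (simp only: mult[symmetric] inj_eq[OF inj] f.scale f.add if_distrib[of f] cong: if_cong)
  ultimately show ?thesis unfolding A'.simplicial_frame_def card by auto
qed

lemma simplicial_frame_simp_gamma:
  assumes "CARD('n::finite) \<ge> 2"
  shows "fd_algebra.simplicial_frame simp_scale simp_times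
    (range (\<lambda>i. simp_gamma (Some i) :: ('k::field_char_0, 'n) simplicial))"
proof -
  interpret fd_comm_algebra "simp_scale :: 'k \<Rightarrow> ('k, 'n) simplicial \<Rightarrow> _" simp_times
    by (rule fd_comm_algebra_simplicial[OF assms])
  show ?thesis unfolding simplicial_frame_def card_image[OF inj_simp_gamma]
    using inj_simp_gamma[where 'k = 'k and 'n = 'n]
    by (auto simp: independent_simp_gamma span_simp_gamma simp_times_gamma[OF assms] inj_eq
      dest: injD)
qed

text \<open>A multiplication table of the shape of a simplicial frame but with idempotents replaced by
  vectors \<open>b\<close> with \<open>b \<odot> b = k\<^sup>-\<^sup>1 \<cdot> b\<close> is normalized by stretching all vectors by \<open>k\<close>.\<close>
lemma (in fd_algebra) simplicial_frame_rescale: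
  assumes B: "independent B" "span B = UNIV" and k: "k \<noteq> 0"
    and mult: "\<And>b c. b \<in> B \<Longrightarrow> c \<in> B \<Longrightarrow>
      b \<odot> c = (if b = c then inverse k \<cdot> b else - (inverse k / (of_nat (card B) - 1)) \<cdot> (b + c))"
  shows "simplicial_frame ((\<lambda>b. k \<cdot> b) ` B)"
proof -
  interpret k: Vector_Spaces.linear scale scale "\<lambda>x. k \<cdot> x" by (rule linear_scale_self)
  have inj: "inj (\<lambda>x. k \<cdot> x)" by (rule injective_scale[OF k])
  let ?C = "(\<lambda>x. k \<cdot> x) ` B"
  have card: "card ?C = card B" by (rule card_image) (rule inj_on_subset[OF inj], simp)
  have "independent ?C"
    using B(1) inj by (intro k.independent_injective_image) (auto intro: inj_on_subset)
  moreover have "span ?C = UNIV"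
  proof -
    have "k \<cdot> inverse k \<cdot> y = y" for y using k by simp
    then have "surj (\<lambda>x. k \<cdot> x)" by (rule surjI)
    then show ?thesis by (simp add: k.span_image B(2))
  qed
  moreover have "(k \<cdot> b) \<odot> (k \<cdot> c) = (if k \<cdot> b = k \<cdot> c then k \<cdot> b
      else - (1 / (of_nat (card B) - 1)) \<cdot> (k \<cdot> b + k \<cdot> c))" if "b \<in> B" "c \<in> B" for b c
  proof -
    define q where "q = 1 / (of_nat (card B) - 1 :: 'k)"
    have "(k \<cdot> b) \<odot> (k \<cdot> c) = (if b = c then (k * (k * inverse k)) \<cdot> b
        else (k * (k * - (inverse k * q))) \<cdot> (b + c))"
      using that
      by (simp add: mult_scale_left mult_scale_right mult q_def divide_inverse
        del: scale_minus_left)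
    also have "\<dots> = (if b = c then k \<cdot> b else - q \<cdot> (k \<cdot> b + k \<cdot> c))"
    proof -
      have k_eqs: "k * (k * inverse k) = k" "k * (k * - (inverse k * q)) = - q * k" using k by simp_all
      then show ?thesis by (simp only: k_eqs scale_right_distrib scale_scale)
    qed
    finally show ?thesis using k by (simp add: q_def)
  qed
  ultimately show ?thesis unfolding simplicial_frame_def card by auto
qed

lemma algebra_isomorphic_simplicial_iff:
  fixes s :: "'k::field_char_0 \<Rightarrow> 'a::ab_group_add \<Rightarrow> 'a"
  assumes alg: "fd_algebra s m" and dim: "vector_space.dim s UNIV = CARD('n::finite)"
    and n: "CARD('n) \<ge> 2"
  shows "algebra_isomorphic s m (simp_scale :: 'k \<Rightarrow> ('k, 'n) simplicial \<Rightarrow> _) simp_times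
    \<longleftrightarrow> (\<exists>B. fd_algebra.simplicial_frame s m B)"
proof
  interpret A: fd_algebra s m by (rule alg)
  interpret E: fd_comm_algebra "simp_scale :: 'k \<Rightarrow> ('k, 'n) simplicial \<Rightarrow> _" simp_times
    by (rule fd_comm_algebra_simplicial[OF n])
  {
    assume "algebra_isomorphic s m (simp_scale :: 'k \<Rightarrow> ('k, 'n) simplicial \<Rightarrow> _) simp_times"
    then obtain f :: "'a \<Rightarrow> ('k, 'n) simplicial" where
      lin: "Vector_Spaces.linear s simp_scale f" and bij: "bij f"
      and mult: "\<And>x y. f (m x y) = simp_times (f x) (f y)"
      unfolding algebra_isomorphic_def by blast
    interpret f: Vector_Spaces.linear s simp_scale f by (rule lin)
    have f_inv: "f (inv f y) = y" for y using bij by (simp add: bij_def surj_f_inv_f)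
    have inv_eqI: "inv f y = x" if "f x = y" for x y
      using bij that by (auto simp: bij_def)
    have "Vector_Spaces.linear simp_scale s (inv f)"
      unfolding Vector_Spaces.linear_iff
      by (auto intro!: inv_eqI A.vector_space_axioms simplicial.vector_space_axioms
        simp: f.add f.scale f_inv)
    moreover have "inv f (simp_times x y) = m (inv f x) (inv f y)" for x y
      by (rule inv_eqI) (simp add: mult f_inv)
    ultimately show "\<exists>B. A.simplicial_frame B"
      using simplicial_frame_image[OF E.fd_algebra_axioms alg _ bij_imp_bij_inv[OF bij] _
        simplicial_frame_simp_gamma[OF n]] by blast
  next
    assume "\<exists>B. A.simplicial_frame B"
    then obtain B where B: "A.simplicial_frame B" by blast
    then have "card B = A.dim UNIV"
      by (auto simp: A.simplicial_frame_def intro: A.card_eq_dim_UNIV)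
    then show "algebra_isomorphic s m (simp_scale :: 'k \<Rightarrow> ('k, 'n) simplicial \<Rightarrow> _) simp_times"
      by (intro algebra_isomorphic_if_frames[OF alg E.fd_algebra_axioms B
        simplicial_frame_simp_gamma[OF n]]) (simp add: dim card_image[OF inj_simp_gamma])
  }
qed

section \<open>Properties of an algebra with a simplicial frame\<close>

locale framed_algebra = fd_comm_algebra scale mult
  for scale :: "'k::field_char_0 \<Rightarrow> 'a::ab_group_add \<Rightarrow> 'a" (infixr \<open>\<cdot>\<close> 75)
    and mult :: "'a \<Rightarrow> 'a \<Rightarrow> 'a" (infixl \<open>\<odot>\<close> 70) +
  fixes B :: "'a set" and r :: 'k
  assumes frame: "simplicial_frame B" and card_B: "card B \<ge> 2"
  defines "r \<equiv> - (1 / (of_nat (card B) - 1))"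
begin

abbreviation coord :: "'a \<Rightarrow> 'a \<Rightarrow> 'k"
  where "coord \<equiv> representation B"

definition coord_sum :: "'a \<Rightarrow> 'k"
  where "coord_sum x = (\<Sum>b\<in>B. coord x b)"

definition coord_dot :: "'a \<Rightarrow> 'a \<Rightarrow> 'k"
  where "coord_dot x y = (\<Sum>b\<in>B. coord x b * coord y b)"

lemma independent_B: "independent B" and span_B: "span B = UNIV"
  using frame by (auto simp: simplicial_frame_def)

lemma finite_B: "finite B"
  using independent_B by (rule finite_independent)

lemma mult_frame:
  "b \<in> B \<Longrightarrow> c \<in> B \<Longrightarrow> b \<odot> c = r \<cdot> (b + c) + (if b = c then (1 - 2 * r) \<cdot> b else 0)"
  using frame
  by (auto simp: simplicial_frame_def r_def scale_left_distrib[symmetric] scale_right_distrib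
    simp del: scale_minus_left)

lemma coord_add: "coord (x + y) b = coord x b + coord y b"
  and coord_diff: "coord (x - y) b = coord x b - coord y b"
  and coord_scale: "coord (t \<cdot> x) b = t * coord x b"
  by (simp_all add: representation_add representation_diff representation_scale
    independent_B span_B)

lemma coord_frame: "b \<in> B \<Longrightarrow> coord b c = (if c = b then 1 else 0)"
  by (simp add: representation_basis independent_B)

lemma coords_eqI: "(\<And>b. b \<in> B \<Longrightarrow> coord x b = coord y b) \<Longrightarrow> x = y"
  using sum_coordinates[OF independent_B span_B, of x] sum_coordinates[OF independent_B span_B, of y]
  by (metis (no_types, lifting) sum.cong)

lemma sum_delta_B: "b \<in> B \<Longrightarrow> (\<Sum>c\<in>B. (if b = c then g c else 0)) = (g b :: 'c::comm_monoid_add)"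
  by (simp add: finite_B)

text \<open>In coordinates the product is the pointwise product of the associative algebra
  \<open>k\<^sup>n\<close>, perturbed by the linear functional \<open>coord_sum\<close>. All later verifications for
  the simplicial algebra start from this formula instead of going through cases of basis vectors.\<close>
lemma coord_mult:
  assumes b: "b \<in> B"
  shows "coord (x \<odot> y) b =
    r * (coord_sum y * coord x b + coord_sum x * coord y b) + (1 - 2 * r) * (coord x b * coord y b)"
proof -
  let ?X = "coord x" and ?Y = "coord y"
  have "x \<odot> y = (\<Sum>c\<in>B. ?X c \<cdot> c) \<odot> (\<Sum>d\<in>B. ?Y d \<cdot> d)"
    by (simp add: sum_coordinates independent_B span_B)
  also have "\<dots> = (\<Sum>c\<in>B. \<Sum>d\<in>B. (?X c * ?Y d) \<cdot> (c \<odot> d))"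
    by (subst mult_sum_left, intro sum.cong refl)
      (simp add: mult_sum_right mult_scale_left mult_scale_right mult.commute)
  finally have "coord (x \<odot> y) b = (\<Sum>c\<in>B. \<Sum>d\<in>B. ?X c * ?Y d * coord (c \<odot> d) b)"
    by (simp add: representation_sum independent_B span_B coord_scale)
  also have "\<dots> = (\<Sum>c\<in>B. \<Sum>d\<in>B. (if b = c then r * (?X c * ?Y d) else 0)
      + ((if b = d then r * (?X c * ?Y d) else 0)
      + (if b = c then if b = d then (1 - 2 * r) * (?X c * ?Y d) else 0 else 0)))"
  proof (intro sum.cong refl)
    fix c d assume "c \<in> B" "d \<in> B"
    then have "coord (c \<odot> d) b = r * ((if b = c then 1 else 0) + (if b = d then 1 else 0))
        + (if b = c then if b = d then 1 - 2 * r else 0 else 0)"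
      by (simp add: mult_frame coord_add coord_scale coord_frame representation_zero
        del: scale_left_diff_distrib)
    then show "?X c * ?Y d * coord (c \<odot> d) b = (if b = c then r * (?X c * ?Y d) else 0)
      + ((if b = d then r * (?X c * ?Y d) else 0)
      + (if b = c then if b = d then (1 - 2 * r) * (?X c * ?Y d) else 0 else 0))"
      by (simp add: algebra_simps)
  qed
  also have "\<dots> = r * (?X b * coord_sum y) + (r * (coord_sum x * ?Y b) + (1 - 2 * r) * (?X b * ?Y b))"
  proof -
    have "(\<Sum>c\<in>B. \<Sum>d\<in>B. (if b = c then g c d else 0)) = (\<Sum>d\<in>B. g b d)"
      for g :: "'a \<Rightarrow> 'a \<Rightarrow> 'k"
    proof -
      have "(\<Sum>c\<in>B. \<Sum>d\<in>B. (if b = c then g c d else 0)) = (\<Sum>c\<in>B. if b = c then \<Sum>d\<in>B. g c d else 0)"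
        by (intro sum.cong) auto
      then show ?thesis by (simp add: sum_delta_B b)
    qed
    then show ?thesis
      by (simp add: sum.distrib sum_delta_B b coord_sum_def sum_distrib_left sum_distrib_right)
  qed
  finally show ?thesis by (simp add: algebra_simps)
qed

lemma coord_sum_scale_add:
  "coord_sum (x + y) = coord_sum x + coord_sum y" "coord_sum (t \<cdot> x) = t * coord_sum x"
  by (simp_all add: coord_sum_def coord_add coord_scale sum.distrib sum_distrib_left)

lemma coord_dot_scale_add:
  "coord_dot (x + y) z = coord_dot x z + coord_dot y z" "coord_dot (t \<cdot> x) z = t * coord_dot x z"
  by (simp_all add: coord_dot_def coord_add coord_scale sum.distrib sum_distrib_left algebra_simps)

lemma coord_dot_commute: "coord_dot x y = coord_dot y x"
  by (simp add: coord_dot_def mult.commute)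

lemma card_minus_one_ne_0: "of_nat (card B) - 1 \<noteq> (0::'k)"
  using card_B by (metis Suc_1 not_less_eq_eq order_refl of_nat_1 of_nat_eq_iff right_minus_eq)

text \<open>This relation expresses that \<open>r = - 1 / (n - 1)\<close> is the value for which the trace of
  multiplication by an element vanishes.\<close>
lemma card_r: "of_nat (card B) * r = r - 1"
  using card_minus_one_ne_0 by (simp add: r_def field_simps)

lemma exact: exact
  unfolding exact_def
proof
  fix x
  have "trace (\<lambda>y. x \<odot> y) = (\<Sum>b\<in>B. coord (x \<odot> b) b)"
    by (rule trace_eq[OF finite_dim independent_B span_B linear_mult_left])
  also have "\<dots> = (\<Sum>b\<in>B. (1 - r) * coord x b + r * coord_sum x)"
  proof (intro sum.cong refl)
    fix b assume b: "b \<in> B"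
    have "coord_sum b = 1" by (simp add: coord_sum_def coord_frame b finite_B)
    then show "coord (x \<odot> b) b = (1 - r) * coord x b + r * coord_sum x"
      by (simp add: coord_mult coord_frame b algebra_simps)
  qed
  also have "\<dots> = (1 - r) * coord_sum x + of_nat (card B) * r * coord_sum x"
    by (simp add: sum.distrib sum_distrib_left coord_sum_def mult.assoc)
  also have "\<dots> = 0" unfolding card_r by (simp add: algebra_simps)
  finally show "trace (\<lambda>y. x \<odot> y) = 0" .
qed

text \<open>The coefficients are read off from the associator: when it is expanded with \<open>coord_mult\<close>, the
  terms with pointwise products cancel by commutativity, and multiples of the first and the third
  argument are left over, the third one with coefficient
  \<open>r\<^sup>2 * coord_sum x * coord_sum y + r * (1 - 2 * r) * coord_dot x y\<close>.
  As \<open>card B * r = r - 1\<close>, this is \<open>- frame_form x y\<close>.\<close>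
definition frame_form :: "'a \<Rightarrow> 'a \<Rightarrow> 'k"
  where "frame_form x y = r\<^sup>2 * ((of_nat (card B) + 1) * coord_dot x y - coord_sum x * coord_sum y)"

lemma frame_form_commute: "frame_form x y = frame_form y x"
  by (simp add: frame_form_def coord_dot_commute mult.commute)

lemma bilinear_frame_form: "bilinear_on scale (*) frame_form"
proof -
  have "Vector_Spaces.linear scale (*) (\<lambda>x. frame_form x y)" for y
    unfolding Vector_Spaces.linear_iff
    by (auto intro: vector_space_axioms vector_space_over_itself.vector_space_axioms
      simp: frame_form_def coord_sum_scale_add coord_dot_scale_add algebra_simps)
  then show ?thesis
    unfolding bilinear_on_def using frame_form_commute by (metis (no_types, lifting) ext)
qed

lemma associator_frame_form: "associator x y z = frame_form y z \<cdot> x - frame_form x y \<cdot> z"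
proof (rule coords_eqI)
  fix b assume b: "b \<in> B"
  have s: "coord_sum (x \<odot> y) = 2 * r * (coord_sum x * coord_sum y) + (1 - 2 * r) * coord_dot x y" for x y
  proof -
    have "coord_sum (x \<odot> y) = (\<Sum>b\<in>B. r * (coord_sum y * coord x b + coord_sum x * coord y b)
        + (1 - 2 * r) * (coord x b * coord y b))"
      unfolding coord_sum_def[of "x \<odot> y"] by (intro sum.cong refl coord_mult)
    also have "\<dots> = r * (coord_sum y * coord_sum x + coord_sum x * coord_sum y)
        + (1 - 2 * r) * coord_dot x y"
      by (simp only: sum.distrib sum_distrib_left[symmetric] coord_sum_def coord_dot_def)
    finally show ?thesis by (simp add: algebra_simps)
  qed
  \<comment> \<open>the coefficient with which \<open>coord_dot\<close> occurs in the expanded associator\<close>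
  have rc: "r\<^sup>2 * (of_nat (card B) + 1) = - (r * (1 - 2 * r))"
  proof -
    have "r\<^sup>2 * (of_nat (card B) + 1) = r * (of_nat (card B) * r + r)"
      by (simp add: power2_eq_square algebra_simps)
    then show ?thesis unfolding card_r by (simp add: algebra_simps)
  qed
  have form: "frame_form x y = - (r * (1 - 2 * r)) * coord_dot x y - r\<^sup>2 * (coord_sum x * coord_sum y)"
    for x y unfolding frame_form_def rc[symmetric] by (simp add: algebra_simps)
  show "coord (associator x y z) b = coord (frame_form y z \<cdot> x - frame_form x y \<cdot> z) b"
    unfolding associator_def coord_diff coord_scale coord_mult[OF b] s form
    by (simp add: algebra_simps power2_eq_square)
qed

lemma projectively_associative: projectively_associative
  unfolding projectively_associative_def
  using bilinear_frame_form frame_form_commute associator_frame_form by blast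

text \<open>Pairing \<open>x\<close> with a frame vector shows that all coordinates of a null vector \<open>x\<close> equal
  \<open>coord_sum x / (n + 1)\<close>; adding up the \<open>n\<close> coordinates forces \<open>coord_sum x = 0\<close>.\<close>
lemma frame_form_nondegenerate:
  assumes "\<And>y. frame_form x y = 0"
  shows "x = 0"
proof (rule coords_eqI)
  fix b assume b: "b \<in> B"
  have r: "r \<noteq> 0" using card_minus_one_ne_0 by (simp add: r_def)
  have *: "(of_nat (card B) + 1) * coord x c = coord_sum x" if "c \<in> B" for c
  proof -
    have "coord_sum c = 1" by (simp add: coord_sum_def coord_frame that finite_B)
    moreover have "coord_dot x c = coord x c"
      by (simp add: coord_dot_def coord_frame that finite_B if_distrib[of "\<lambda>t. _ * t"] cong: if_cong)
    ultimately show ?thesis using assms[of c] r by (simp add: frame_form_def)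
  qed
  have "(of_nat (card B) + 1) * coord_sum x = (\<Sum>c\<in>B. (of_nat (card B) + 1) * coord x c)"
    by (simp add: coord_sum_def sum_distrib_left)
  also have "\<dots> = of_nat (card B) * coord_sum x" by (simp add: *)
  finally have "coord_sum x = 0" by (simp add: algebra_simps)
  moreover have "of_nat (card B) + 1 \<noteq> (0::'k)"
    by (metis of_nat_Suc of_nat_eq_0_iff add.commute nat.distinct(1))
  ultimately show "coord x b = coord 0 b" using *[OF b] by (simp add: representation_zero)
qed

end

text \<open>By the Cauchy-Schwarz inequality \<open>(coord_sum x)\<^sup>2 \<le> n * coord_dot x x\<close>, which leaves one
  copy of \<open>coord_dot x x\<close> over.\<close>
lemma frame_form_positive:
  fixes s :: "real \<Rightarrow> 'a::ab_group_add \<Rightarrow> 'a"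
  assumes "framed_algebra s m B" and "x \<noteq> 0"
  shows "framed_algebra.frame_form s B x x > 0"
proof -
  interpret framed_algebra s m B "- (1 / (real (card B) - 1))" by fact
  obtain b where "b \<in> B" "coord x b \<noteq> 0"
    using assms(2) coords_eqI[of x 0] by (auto simp: representation_zero)
  then have pos: "coord_dot x x > 0"
    unfolding coord_dot_def by (intro sum_pos2[OF finite_B]) (auto simp: zero_less_mult_iff linorder_neq_iff)
  have "(coord_sum x)\<^sup>2 \<le> of_nat (card B) * coord_dot x x"
    using sum_squared_le_sum_of_squares[of "coord x" B] finite_B
    by (simp add: coord_sum_def coord_dot_def power2_eq_square mult.commute)
  then have "0 < (of_nat (card B) + 1) * coord_dot x x - coord_sum x * coord_sum x"
    using pos by (simp add: power2_eq_square algebra_simps)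
  then show ?thesis unfolding frame_form_def using card_minus_one_ne_0 by simp
qed

section \<open>Eigenvectors in invariant subspaces\<close>

text \<open>The operator \<open>p(f)\<close> applied to \<open>v\<close>, by Horner's scheme.\<close>
definition (in vector_space) poly_op :: "('b \<Rightarrow> 'b) \<Rightarrow> 'a poly \<Rightarrow> 'b \<Rightarrow> 'b"
  where "poly_op f p v = foldr (\<lambda>a w. scale a v + f w) (coeffs p) 0"

context vector_space
begin

context
  fixes f :: "'b \<Rightarrow> 'b"
  assumes f: "Vector_Spaces.linear scale scale f"
begin

interpretation f: Vector_Spaces.linear scale scale f by (rule f)

lemma poly_op_0 [simp]: "poly_op f 0 v = 0"
  by (simp add: poly_op_def)

lemma poly_op_pCons [simp]: "poly_op f (pCons a p) v = scale a v + f (poly_op f p v)"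
  by (cases "a = 0 \<and> p = 0") (auto simp: poly_op_def cCons_def f.zero)

lemma poly_op_add: "poly_op f (p + q) v = poly_op f p v + poly_op f q v"
  by (induction p q rule: poly_induct2) (simp_all add: scale_left_distrib f.add algebra_simps)

lemma poly_op_smult: "poly_op f (smult a p) v = scale a (poly_op f p v)"
  by (induction p) (simp_all add: scale_right_distrib f.scale)

lemma poly_op_mult: "poly_op f (p * q) v = poly_op f p (poly_op f q v)"
  by (induction p) (simp_all add: poly_op_add poly_op_smult)

lemma poly_op_sum: "poly_op f (sum p I) v = (\<Sum>i\<in>I. poly_op f (p i) v)"
  by (induction I rule: infinite_finite_induct) (simp_all add: poly_op_add)

lemma poly_op_monom: "poly_op f (monom a i) v = scale a ((f ^^ i) v)"
  by (induction i) (simp_all add: monom_0 monom_Suc f.zero f.scale)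

lemma poly_op_in_subspace:
  assumes "subspace V" "\<And>w. w \<in> V \<Longrightarrow> f w \<in> V" "v \<in> V"
  shows "poly_op f p v \<in> V"
  by (induction p) (auto intro!: assms subspace_0 subspace_add subspace_scale)

end
end

text \<open>In dimension \<open>n\<close>, the vectors \<open>v, f v, \<dots>, f\<^sup>n v\<close> cannot be distinct and independent; either kind of
  coincidence is the value of a nonzero polynomial in \<open>f\<close>.\<close>
lemma (in finite_dimensional_vector_space) ex_annihilating_poly:
  assumes f: "Vector_Spaces.linear scale scale f"
  shows "\<exists>p. p \<noteq> 0 \<and> poly_op f p v = 0"
proof -
  let ?x = "\<lambda>i. (f ^^ i) v"
  let ?I = "{..card Basis}"
  show ?thesis
  proof (cases "inj_on ?x ?I")
    case False
    then obtain i j where ij: "i \<noteq> j" "?x i = ?x j" by (auto simp: inj_on_def)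
    define p :: "'a poly" where "p = monom 1 i + monom (- 1) j"
    have "coeff p i = 1" using ij by (simp add: p_def)
    moreover have "poly_op f p v = 0"
      using ij by (simp add: p_def poly_op_add[OF f] poly_op_monom[OF f])
    ultimately show ?thesis by (metis coeff_0 zero_neq_one)
  next
    case True
    then have "card (?x ` ?I) > dim UNIV" by (simp add: card_image dim_UNIV)
    then have "dependent (?x ` ?I)"
      using independent_card_le_dim[of "?x ` ?I" UNIV] by auto
    then obtain u where u: "(\<Sum>y\<in>?x ` ?I. scale (u y) y) = 0" "\<exists>y\<in>?x ` ?I. u y \<noteq> 0"
      using dependent_finite[of "?x ` ?I"] by auto
    define p where "p = (\<Sum>i\<in>?I. monom (u (?x i)) i)"
    have "poly_op f p v = 0"
      using u(1) by (simp add: p_def poly_op_sum[OF f] poly_op_monom[OF f] sum.reindex[OF True])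
    moreover obtain i where "i \<in> ?I" "u (?x i) \<noteq> 0" using u(2) by auto
    then have "coeff p i \<noteq> 0" by (simp add: p_def coeff_sum)
    ultimately show ?thesis by (metis coeff_0)
  qed
qed

text \<open>A polynomial of least degree for which \<open>p(f)\<close> kills some nonzero \<open>w \<in> V\<close>. If \<open>p = q * r\<close> with
  \<open>q\<close> nonconstant, then \<open>r(f) w\<close> is nonzero by minimality and is killed by \<open>q(f)\<close>. Thus every nonconstant
  factor of \<open>p\<close>, in particular every irreducible one, has a kernel in \<open>V\<close>.\<close>
lemma (in finite_dimensional_vector_space) invariant_subspace_poly:
  assumes f: "Vector_Spaces.linear scale scale f"
    and V: "subspace V" "\<And>w. w \<in> V \<Longrightarrow> f w \<in> V" "V \<noteq> {0}"
  obtains p where "degree p > 0"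
    and "\<And>q r. p = q * r \<Longrightarrow> degree q > 0 \<Longrightarrow> \<exists>w\<in>V. w \<noteq> 0 \<and> poly_op f q w = 0"
proof -
  interpret f: Vector_Spaces.linear scale scale f by (rule f)
  let ?ann = "\<lambda>p. p \<noteq> 0 \<and> (\<exists>w\<in>V. w \<noteq> 0 \<and> poly_op f p w = 0)"
  obtain v where v: "v \<in> V" "v \<noteq> 0" using V(3) subspace_0[OF V(1)] by auto
  then have "\<exists>p. ?ann p" using ex_annihilating_poly[OF f, of v] by blast
  then obtain p where p: "?ann p" and least: "\<And>q. ?ann q \<Longrightarrow> degree p \<le> degree q"
    using ex_has_least_nat[of ?ann _ degree] by blast
  obtain w where w: "w \<in> V" "w \<noteq> 0" "poly_op f p w = 0" using p by blast
  show thesis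
  proof
    show "degree p > 0"
    proof (rule ccontr)
      assume "\<not> degree p > 0"
      then obtain a where "p = [:a:]" by (metis degree_eq_zeroE neq0_conv)
      then show False using p w
        by (auto simp: poly_op_pCons[OF f] poly_op_0[OF f] f.zero)
    qed
    fix q r assume qr: "p = q * r" "degree q > 0"
    then have nz: "q \<noteq> 0" "r \<noteq> 0" using p by auto
    then have "degree r < degree p" using qr by (simp add: degree_mult_eq)
    then have "poly_op f r w \<noteq> 0" using least[of r] nz w by force
    moreover have "poly_op f r w \<in> V" by (rule poly_op_in_subspace[OF f V(1,2) w(1)])
    moreover have "poly_op f q (poly_op f r w) = 0"
      using w(3) by (simp add: qr poly_op_mult[OF f])
    ultimately show "\<exists>w\<in>V. w \<noteq> 0 \<and> poly_op f q w = 0" by blast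
  qed
qed

lemma eigenvector_alg_closed:
  fixes s :: "'k::alg_closed_field \<Rightarrow> 'a::ab_group_add \<Rightarrow> 'a"
  assumes "finite_dimensional_vector_space s D"
    and f: "Vector_Spaces.linear s s f"
    and V: "module.subspace s V" "\<And>w. w \<in> V \<Longrightarrow> f w \<in> V" "V \<noteq> {0}"
  shows "\<exists>w\<in>V. w \<noteq> 0 \<and> (\<exists>t. f w = s t w)"
proof -
  interpret finite_dimensional_vector_space s D by fact
  interpret f: Vector_Spaces.linear s s f by (rule f)
  obtain p where p: "degree p > 0"
    and ker: "\<And>q r. p = q * r \<Longrightarrow> degree q > 0 \<Longrightarrow> \<exists>w\<in>V. w \<noteq> 0 \<and> poly_op f q w = 0"
    using invariant_subspace_poly[OF f V] by metis
  obtain t where "poly p t = 0" using alg_closed_imp_poly_has_root[OF p] by blast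
  then obtain r where "p = [:- t, 1:] * r" by (auto simp: poly_eq_0_iff_dvd dvd_def)
  then obtain w where "w \<in> V" "w \<noteq> 0" "poly_op f [:- t, 1:] w = 0" using ker by fastforce
  then show ?thesis
    by (auto simp: poly_op_pCons[OF f] poly_op_0[OF f] f.zero intro!: bexI[of _ w] exI[of _ t])
qed

text \<open>The factor is the minimal polynomial over the reals of a complex root.\<close>
lemma real_poly_linear_or_quadratic_factor:
  fixes p :: "real poly"
  assumes "degree p > 0"
  shows "(\<exists>t. [:- t, 1:] dvd p) \<or> (\<exists>a b. b \<noteq> 0 \<and> [:a\<^sup>2 + b\<^sup>2, - 2 * a, 1:] dvd p)"
proof -
  define ev where "ev q z = poly (map_poly complex_of_real q) z" for q z
  have ev_pCons: "ev (pCons a q) z = of_real a + z * ev q z" for a q z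
    by (simp add: ev_def map_poly_pCons)
  have ev_0: "ev 0 z = 0" for z by (simp add: ev_def)
  have ev_add: "ev (q + r) z = ev q z + ev r z" for q r z
    by (induction q r rule: poly_induct2) (simp_all add: ev_pCons ev_0 algebra_simps)
  have ev_smult: "ev (smult a q) z = of_real a * ev q z" for a q z
    by (induction q) (simp_all add: ev_pCons ev_0 algebra_simps)
  have ev_mult: "ev (q * r) z = ev q z * ev r z" for q r z
    by (induction q) (simp_all only: mult_pCons_left mult_zero_left ev_pCons ev_0 ev_add ev_smult
      of_real_0 add_0 distrib_right mult.assoc)
  have ev_real: "ev q (of_real t) = of_real (poly q t)" for q t
    by (induction q) (simp_all add: ev_pCons ev_0)
  have "degree (map_poly complex_of_real p) > 0" using assms by (simp add: degree_map_poly)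
  from alg_closed_imp_poly_has_root[OF this] obtain z where z: "ev p z = 0"
    by (auto simp: ev_def)
  define Q :: "real poly" where "Q = [:(Re z)\<^sup>2 + (Im z)\<^sup>2, - 2 * Re z, 1:]"
  have Qz: "ev Q z = 0"
    by (simp add: Q_def ev_pCons ev_0 complex_eq_iff power2_eq_square algebra_simps)
  show ?thesis
  proof (cases "Im z = 0")
    case True
    then have "z = complex_of_real (Re z)" by (simp add: complex_eq_iff)
    then have "complex_of_real (poly p (Re z)) = 0"
      using z by (metis ev_real)
    then show ?thesis by (auto simp: poly_eq_0_iff_dvd)
  next
    case False
    define s where "s = p mod Q"
    have "degree s < 2"
      using degree_mod_less[of Q p] by (auto simp: s_def Q_def)
    then have "coeff s i = coeff [:coeff s 0, coeff s 1:] i" for i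
      by (cases i rule: nat.exhaust; cases "i - 1") (auto simp: coeff_eq_0)
    then have "s = [:coeff s 0, coeff s 1:]" by (rule poly_eqI)
    then obtain a b where ab: "s = [:a, b:]" by blast
    have "ev p z = ev (Q * (p div Q) + s) z" by (simp add: s_def)
    then have "ev p z = ev s z" by (simp only: ev_add ev_mult Qz mult_zero_left add_0_left)
    with z have "of_real a + of_real b * z = 0" by (simp add: ab ev_pCons ev_0 mult.commute)
    then have "b = 0 \<and> a = 0" using False by (auto simp: complex_eq_iff)
    then have "Q dvd p" using ab by (simp add: s_def dvd_eq_mod_eq_0)
    with False show ?thesis unfolding Q_def by blast
  qed
qed

text \<open>A quadratic factor \<open>(X - a)\<^sup>2 + b\<^sup>2\<close> with \<open>b \<noteq> 0\<close> cannot occur: for \<open>w\<close> in the kernel of its value at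
  a self-adjoint \<open>f\<close>, and \<open>u = f w - a w\<close>, it would give \<open>h u u + b\<^sup>2 * h w w = 0\<close>, against positivity.\<close>
lemma eigenvector_real_self_adjoint:
  fixes s :: "real \<Rightarrow> 'a::ab_group_add \<Rightarrow> 'a" and h :: "'a \<Rightarrow> 'a \<Rightarrow> real"
  assumes "finite_dimensional_vector_space s D"
    and f: "Vector_Spaces.linear s s f"
    and h: "bilinear_on s (*) h" "\<And>x. x \<noteq> 0 \<Longrightarrow> h x x > 0" "\<And>x y. h (f x) y = h x (f y)"
    and V: "module.subspace s V" "\<And>w. w \<in> V \<Longrightarrow> f w \<in> V" "V \<noteq> {0}"
  shows "\<exists>w\<in>V. w \<noteq> 0 \<and> (\<exists>t. f w = s t w)"
proof -
  interpret finite_dimensional_vector_space s D by fact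
  interpret f: Vector_Spaces.linear s s f by (rule f)
  note ops = poly_op_pCons[OF f] poly_op_0[OF f] f.zero
  have hl: "h (x + y) z = h x z + h y z" "h (s t x) z = t * h x z"
    and hr: "h z (x + y) = h z x + h z y" "h z (s t x) = t * h z x" for x y z t
    using h(1) unfolding bilinear_on_def Vector_Spaces.linear_iff by blast+
  obtain p where p: "degree p > 0"
    and ker: "\<And>q r. p = q * r \<Longrightarrow> degree q > 0 \<Longrightarrow> \<exists>w\<in>V. w \<noteq> 0 \<and> poly_op f q w = 0"
    using invariant_subspace_poly[OF f V] by metis
  from real_poly_linear_or_quadratic_factor[OF p] show ?thesis
  proof (elim disjE exE conjE)
    fix t assume "[:- t, 1:] dvd p"
    then obtain w where "w \<in> V" "w \<noteq> 0" "poly_op f [:- t, 1:] w = 0"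
      using ker[of "[:- t, 1:]"] by (auto simp: dvd_def)
    then show ?thesis by (auto simp: ops intro!: bexI[of _ w] exI[of _ t])
  next
    fix a b assume b: "b \<noteq> (0::real)" and "[:a\<^sup>2 + b\<^sup>2, - 2 * a, 1:] dvd p"
    then obtain w where w: "w \<noteq> 0" "poly_op f [:a\<^sup>2 + b\<^sup>2, - 2 * a, 1:] w = 0"
      using ker[of "[:a\<^sup>2 + b\<^sup>2, - 2 * a, 1:]"] by (auto simp: dvd_def)
    then have "s (a\<^sup>2 + b\<^sup>2) w + (s (- 2 * a) (f w) + f (f w)) = 0"
      by (simp only: ops f.add f.scale) (simp add: f.add f.scale f.neg f.diff ops)
    then have "h (s (a\<^sup>2 + b\<^sup>2) w + (s (- 2 * a) (f w) + f (f w))) w = 0"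
      using hl(2)[of 0 0 w] by simp
    then have 1: "(a\<^sup>2 + b\<^sup>2) * h w w + (- 2 * a * h (f w) w + h (f w) (f w)) = 0"
      by (simp only: hl h(3)[of "f w"])
    define u where "u = f w + s (- a) w"
    have "h u u = h (f w) (f w) - 2 * a * h (f w) w + a\<^sup>2 * h w w"
      by (simp only: u_def hl hr h(3)[of w w, symmetric]) (simp add: algebra_simps power2_eq_square)
    with 1 have "h u u + b\<^sup>2 * h w w = 0" by (simp add: algebra_simps)
    moreover have "h u u \<ge> 0"
      using h(2)[of u] hl(2)[of 0 0 0] by (cases "u = 0") auto
    moreover have "b\<^sup>2 * h w w > 0" using h(2)[OF w(1)] b by simp
    ultimately show ?thesis by linarith
  qed
qed

section \<open>Orthogonal idempotents in associative algebras\<close>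

locale fd_comm_assoc_algebra = fd_comm_algebra +
  assumes mult_assoc: "mult (mult x y) z = mult x (mult y z)"
begin

definition is_ideal :: "'b set \<Rightarrow> bool"
  where "is_ideal I \<longleftrightarrow> subspace I \<and> (\<forall>x\<in>I. \<forall>u. u \<odot> x \<in> I)"

text \<open>Take a nonzero ideal of least dimension inside \<open>J\<close>. The eigenspaces of multiplication
  operators in it are again ideals, by commutativity and associativity, so each multiplication
  operator acts on it as a scalar.\<close>
lemma ideal_contains_joint_eigenvector:
  assumes eigen: "\<And>I u. is_ideal I \<Longrightarrow> I \<noteq> {0} \<Longrightarrow> \<exists>v\<in>I. v \<noteq> 0 \<and> (\<exists>t. u \<odot> v = t \<cdot> v)"
    and J: "is_ideal J" "J \<noteq> {0}"
  shows "\<exists>v\<in>J. v \<noteq> 0 \<and> (\<forall>u. \<exists>t. u \<odot> v = t \<cdot> v)"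
proof -
  obtain D where "finite_dimensional_vector_space scale D" using finite_dimensional by blast
  then interpret finite_dimensional_vector_space scale D .
  let ?P = "\<lambda>I. is_ideal I \<and> I \<noteq> {0} \<and> I \<subseteq> J"
  have "?P J" using J by blast
  then obtain I where I: "?P I" and least: "\<And>K. ?P K \<Longrightarrow> dim I \<le> dim K"
    using ex_has_least_nat[of ?P J dim] by blast
  have sub: "subspace I" and closed: "\<And>x u. x \<in> I \<Longrightarrow> u \<odot> x \<in> I"
    using I by (auto simp: is_ideal_def)
  obtain v where v: "v \<in> I" "v \<noteq> 0" using I subspace_0[OF sub] by auto
  have "\<exists>t. u \<odot> v = t \<cdot> v" for u
  proof -
    obtain w t where w: "w \<in> I" "w \<noteq> 0" "u \<odot> w = t \<cdot> w" using eigen[of I u] I by blast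
    define K where "K = {y \<in> I. u \<odot> y = t \<cdot> y}"
    have subK: "subspace K"
      unfolding subspace_def K_def
      by (auto simp: mult_add_right mult_scale_right scale_right_distrib scale_left_commute
        intro!: subspace_0[OF sub] subspace_add[OF sub] subspace_scale[OF sub])
    have "u \<odot> (y \<odot> x) = t \<cdot> (y \<odot> x)" if "u \<odot> x = t \<cdot> x" for x y
      using that by (metis mult_assoc mult_commute mult_scale_right)
    then have "is_ideal K" using subK closed by (auto simp: is_ideal_def K_def)
    moreover have "w \<in> K" using w by (simp add: K_def)
    ultimately have "dim I \<le> dim K" using w(2) I by (intro least) (auto simp: K_def)
    then have "K = I" by (intro subspace_dim_equal subK sub) (auto simp: K_def)
    then show ?thesis using v(1) by (auto simp: K_def)
  qed
  then show ?thesis using v I by blast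
qed

definition orthogonal_idempotents :: "'b set \<Rightarrow> bool"
  where "orthogonal_idempotents E \<longleftrightarrow> (\<forall>e\<in>E. \<forall>f\<in>E. e \<odot> f = (if e = f then e else 0))"

lemma mult_orthogonal_idempotents_sum:
  assumes "orthogonal_idempotents E" "finite E" "e \<in> E"
  shows "e \<odot> (\<Sum>f\<in>E. t f \<cdot> f) = t e \<cdot> e"
proof -
  have "e \<odot> (\<Sum>f\<in>E. t f \<cdot> f) = (\<Sum>f\<in>E. if e = f then t f \<cdot> f else 0)"
    unfolding mult_sum_right using assms
    by (intro sum.cong) (auto simp: mult_scale_right orthogonal_idempotents_def)
  then show ?thesis using assms by simp
qed

lemma independent_orthogonal_idempotents:
  assumes E: "orthogonal_idempotents E" and "0 \<notin> E"
  shows "independent E"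
  unfolding independent_explicit_finite_subsets
proof (intro allI impI ballI)
  fix S t e assume S: "S \<subseteq> E" "finite S" "(\<Sum>f\<in>S. t f \<cdot> f) = 0" "e \<in> S"
  have "orthogonal_idempotents S" using E S(1) by (simp add: orthogonal_idempotents_def subset_iff)
  then have "t e \<cdot> e = e \<odot> (\<Sum>f\<in>S. t f \<cdot> f)"
    using S by (intro mult_orthogonal_idempotents_sum[symmetric])
  then show "t e = 0" using S assms(2) by auto
qed

text \<open>A commutative associative algebra that is split (multiplication operators have eigenvectors
  in ideals) and without nilpotents is a product of copies of the ground field. Take a largest
  set of orthogonal idempotents spanning one-dimensional ideals. Its annihilator \<open>J\<close> is an ideal; a
  joint eigenvector \<open>v\<close> in a nonzero \<open>J\<close> could be rescaled to one more idempotent of this kind. So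
  \<open>J = 0\<close>, and as \<open>y\<close> minus its components \<open>f \<odot> y\<close> always lies in \<open>J\<close>, the idempotents span.
  The condition \<open>reduced\<close> concerns generators of one-dimensional ideals only, which is where
  absence of nilpotents is easiest to check.\<close>
theorem orthogonal_idempotent_basis:
  assumes eigen: "\<And>I u. is_ideal I \<Longrightarrow> I \<noteq> {0} \<Longrightarrow> \<exists>v\<in>I. v \<noteq> 0 \<and> (\<exists>t. u \<odot> v = t \<cdot> v)"
    and reduced: "\<And>v. v \<noteq> 0 \<Longrightarrow> (\<forall>u. \<exists>t. u \<odot> v = t \<cdot> v) \<Longrightarrow> v \<odot> v \<noteq> 0"
  shows "\<exists>E. independent E \<and> span E = UNIV \<and> orthogonal_idempotents E"
proof -
  obtain D where "finite_dimensional_vector_space scale D" using finite_dimensional by blast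
  then interpret finite_dimensional_vector_space scale D .
  let ?P = "\<lambda>E. orthogonal_idempotents E \<and> 0 \<notin> E \<and> (\<forall>e\<in>E. \<forall>u. \<exists>t. u \<odot> e = t \<cdot> e)"
  have "?P {}" by (simp add: orthogonal_idempotents_def)
  moreover have "\<forall>E. ?P E \<longrightarrow> card E < Suc (dim UNIV)"
    using independent_orthogonal_idempotents independent_card_le_dim
    by (auto simp: less_Suc_eq_le simp del: dim_UNIV)
  ultimately obtain E where E: "?P E" and max: "\<And>F. ?P F \<Longrightarrow> card F \<le> card E"
    using ex_has_greatest_nat[of ?P "{}" card "Suc (dim UNIV)"] by blast
  have indep: "independent E" using E independent_orthogonal_idempotents by blast
  have fin: "finite E" by (rule finite_independent[OF indep])
  define J where "J = {y. \<forall>e\<in>E. e \<odot> y = 0}"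
  have ideal: "is_ideal J"
    unfolding is_ideal_def subspace_def J_def
    by (auto simp: mult_add_right mult_scale_right) (metis mult_assoc mult_commute mult_zero_right)
  have "J = {0}"
  proof (rule ccontr)
    assume "J \<noteq> {0}"
    then obtain v where v: "v \<in> J" "v \<noteq> 0" and line: "\<forall>u. \<exists>t. u \<odot> v = t \<cdot> v"
      using ideal_contains_joint_eigenvector[OF eigen ideal] by blast
    obtain t where t: "v \<odot> v = t \<cdot> v" using line by blast
    then have t0: "t \<noteq> 0" using reduced[OF v(2) line] by auto
    define e where "e = inverse t \<cdot> v"
    have "e \<in> J" "e \<noteq> 0" using v t0 ideal by (auto simp: e_def is_ideal_def subspace_scale)
    have ee: "e \<odot> e = e" using t0 by (simp add: e_def mult_scale_left mult_scale_right t)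
    have "\<exists>s. u \<odot> e = s \<cdot> e" for u
    proof -
      obtain s where "u \<odot> v = s \<cdot> v" using line by blast
      then have "u \<odot> e = s \<cdot> e" by (simp add: e_def mult_scale_right mult.commute)
      then show ?thesis by blast
    qed
    moreover have orth: "f \<odot> e = 0" "e \<odot> f = 0" if "f \<in> E" for f
      using \<open>e \<in> J\<close> that by (auto simp: J_def mult_commute)
    moreover have "e \<notin> E" using orth(1)[of e] ee \<open>e \<noteq> 0\<close> by auto
    ultimately have "?P (insert e E)" using E ee \<open>e \<noteq> 0\<close>
      by (auto simp: orthogonal_idempotents_def)
    from max[OF this] show False using \<open>e \<notin> E\<close> fin by simp
  qed
  have "y \<in> span E" for y
  proof -
    have "e \<odot> (y - (\<Sum>f\<in>E. f \<odot> y)) = 0" if "e \<in> E" for e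
    proof -
      have "e \<odot> (\<Sum>f\<in>E. f \<odot> y) = (\<Sum>f\<in>E. if e = f then f \<odot> y else 0)"
        unfolding mult_sum_right using E that
        by (intro sum.cong) (auto simp: mult_assoc[symmetric] orthogonal_idempotents_def)
      then show ?thesis using that fin by (simp add: mult_diff_right)
    qed
    then have "y - (\<Sum>f\<in>E. f \<odot> y) \<in> J" by (simp add: J_def)
    then have "y = (\<Sum>f\<in>E. f \<odot> y)" using \<open>J = {0}\<close> by simp
    also have "\<dots> \<in> span E"
    proof (rule span_sum)
      fix f assume f: "f \<in> E"
      then obtain t where "y \<odot> f = t \<cdot> f" using E by blast
      then show "f \<odot> y \<in> span E" using f by (auto simp: mult_commute[of f] intro: span_scale span_base)
    qed
    finally show ?thesis .
  qed
  then show ?thesis using indep E by blast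
qed

end

section \<open>The associator form of a projectively associative algebra\<close>

context fd_comm_algebra
begin

definition associator_form :: "('b \<Rightarrow> 'b \<Rightarrow> 'a) \<Rightarrow> bool"
  where "associator_form c \<longleftrightarrow> bilinear_on scale (*) c \<and> (\<forall>x y. c x y = c y x) \<and>
    (\<forall>x y z. associator x y z = c y z \<cdot> x - c x y \<cdot> z)"

text \<open>The trace, as an operator in \<open>z\<close>, of
  \<open>x \<odot> (y \<odot> z) = (x \<odot> y) \<odot> z - c y z \<cdot> x + c x y \<cdot> z\<close>. On the right, the first term is traceless by
  exactness, the second has rank one and trace \<open>c x y\<close>, and the third is a multiple of the identity.
  So the form \<open>c\<close> inherits nondegeneracy and definiteness from the Killing form.\<close>
lemma killing_eq_associator_form:
  assumes exact and c: "associator_form c"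
  shows "killing x y = (of_nat (dim UNIV) - 1) * c x y"
proof -
  have lin: "Vector_Spaces.linear scale (*) (\<lambda>z. c y z)"
    using c by (auto simp: associator_form_def bilinear_on_def)
  have "x \<odot> (y \<odot> z) = (x \<odot> y) \<odot> z - c y z \<cdot> x + c x y \<cdot> z" for z
    using c by (auto simp: associator_form_def associator_def algebra_simps)
  then have "killing x y = trace (\<lambda>z. (x \<odot> y) \<odot> z - c y z \<cdot> x + c x y \<cdot> z)"
    by (simp add: killing_def)
  also have "\<dots> = trace (\<lambda>z. (x \<odot> y) \<odot> z) - c y x + c x y * of_nat (dim UNIV)"
    by (simp add: trace_add trace_diff trace_scale trace_id trace_rank_one[OF lin])
  also have "\<dots> = (of_nat (dim UNIV) - 1) * c x y"
    using assms by (simp add: exact_def associator_form_def algebra_simps)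
  finally show ?thesis .
qed

text \<open>An identity in every nonassociative algebra: each of the five bracketings of four factors
  occurs twice, with opposite signs or on opposite sides.\<close>
lemma associator_pentagon:
  "a \<odot> associator x y z + associator a x y \<odot> z =
    associator (a \<odot> x) y z - associator a (x \<odot> y) z + associator a x (y \<odot> z)"
  by (simp add: associator_def mult_diff_left mult_diff_right)

text \<open>Inserting the formula for the associator into \<open>associator_pentagon\<close>, all terms cancel except
  multiples of \<open>x\<close> and of the last argument \<open>d\<close>, the latter with coefficient
  \<open>c x (y \<odot> z) - c (x \<odot> y) z\<close>. In dimension at least two, \<open>d\<close> can be chosen outside the line of \<open>x\<close>.\<close>
lemma associator_form_invariant:
  assumes c: "associator_form c" and dim: "dim UNIV \<ge> 2"
  shows "c (x \<odot> y) z = c x (y \<odot> z)"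
proof (cases "x = 0")
  case True
  have "Vector_Spaces.linear scale (*) (\<lambda>x. c x z)" for z
    using c by (auto simp: associator_form_def bilinear_on_def)
  then have "c (0 \<cdot> 0) z = 0 * c 0 z" for z unfolding Vector_Spaces.linear_iff by blast
  then show ?thesis using True by simp
next
  case False
  have "span {x} \<noteq> UNIV"
    using dim dim_le_card[of UNIV "{x}"] by auto
  then obtain d where d: "d \<notin> span {x}" by blast
  have assoc: "associator x y z = c y z \<cdot> x - c x y \<cdot> z" for x y z
    using c by (simp add: associator_form_def)
  define t where "t = c x (y \<odot> z) - c (x \<odot> y) z"
  have "t \<cdot> d = (c (y \<odot> z) d - c y (z \<odot> d)) \<cdot> x"
    using associator_pentagon[of x y z d] unfolding assoc t_def
    by (simp add: mult_diff_left mult_diff_right mult_scale_left mult_scale_right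
      scale_left_diff_distrib algebra_simps)
  then have "t \<cdot> d \<in> span {x}" by (simp add: span_base span_scale)
  then have "t = 0" using d span_scale[of "t \<cdot> d" "{x}" "inverse t"] by (cases "t = 0") auto
  then show ?thesis by (simp add: t_def)
qed

end

section \<open>The unitization\<close>

locale associator_form_algebra = fd_comm_algebra scale mult
  for scale :: "'k::field_char_0 \<Rightarrow> 'a::ab_group_add \<Rightarrow> 'a" (infixr \<open>\<cdot>\<close> 75)
    and mult :: "'a \<Rightarrow> 'a \<Rightarrow> 'a" (infixl \<open>\<odot>\<close> 70) +
  fixes c :: "'a \<Rightarrow> 'a \<Rightarrow> 'k"
  assumes form: "associator_form c"
    and dim_ge_2: "dim UNIV \<ge> 2"
    and exact: exact
    and nondegenerate: "\<And>x. (\<And>y. c x y = 0) \<Longrightarrow> x = 0"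
begin

definition unit_scale :: "'k \<Rightarrow> 'a \<times> 'k \<Rightarrow> 'a \<times> 'k"
  where "unit_scale t u = (t \<cdot> fst u, t * snd u)"

text \<open>In the unitization \<open>A \<times> k\<close>, an element \<open>(x, a)\<close> stands for \<open>x + a 1\<close>. The term
  \<open>c (fst u) (fst v)\<close> adds to the product of two vectors of \<open>A\<close> a multiple of the unit \<open>(0, 1)\<close>, chosen so
  that it cancels the associator of \<open>A\<close>.\<close>
definition unit_mult :: "'a \<times> 'k \<Rightarrow> 'a \<times> 'k \<Rightarrow> 'a \<times> 'k"
  where "unit_mult u v =
    (fst u \<odot> fst v + snd u \<cdot> fst v + snd v \<cdot> fst u, c (fst u) (fst v) + snd u * snd v)"

lemma c_linear:
  "c (x + y) z = c x z + c y z" "c (t \<cdot> x) z = t * c x z"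
  "c z (x + y) = c z x + c z y" "c z (t \<cdot> x) = t * c z x"
  using form unfolding associator_form_def bilinear_on_def Vector_Spaces.linear_iff by blast+

lemma c_commute: "c x y = c y x"
  using form unfolding associator_form_def by blast

lemma c_zero [simp]: "c 0 x = 0" "c x 0 = 0"
  using c_linear(2)[of 0 0 x] c_linear(4)[of x 0 0] by auto

text \<open>For associativity, the components in \<open>A\<close> agree by the formula for the associator, and the
  components in \<open>k\<close> by invariance of \<open>c\<close>.\<close>
sublocale unitization: fd_comm_assoc_algebra unit_scale unit_mult
proof -
  have vs: "vector_space unit_scale"
    by unfold_locales (auto simp: unit_scale_def algebra_simps scale_left_distrib scale_right_distrib)
  then interpret U: vector_space unit_scale .
  have incl: "Vector_Spaces.linear scale unit_scale (\<lambda>x. (x, 0))"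
    unfolding Vector_Spaces.linear_iff by (auto intro: vs vector_space_axioms simp: unit_scale_def)
  interpret incl: Vector_Spaces.linear scale unit_scale "\<lambda>x. (x, 0)" by (rule incl)
  obtain S where S: "finite S" "span S = UNIV" using finite_dim by blast
  let ?T = "insert (0, 1) ((\<lambda>x. (x, 0)) ` S)"
  have "u \<in> U.span ?T" for u
  proof -
    have "(fst u, 0) \<in> U.span ((\<lambda>x. (x, 0)) ` S)" by (simp add: incl.span_image S)
    then have "(fst u, 0) \<in> U.span ?T" by (rule subsetD[OF U.span_mono, rotated]) auto
    moreover have "unit_scale (snd u) (0, 1) \<in> U.span ?T"
      by (intro U.span_scale U.span_base) simp
    ultimately have "(fst u, 0) + unit_scale (snd u) (0, 1) \<in> U.span ?T" by (rule U.span_add)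
    then show ?thesis by (simp add: unit_scale_def)
  qed
  then have fin: "\<exists>T. finite T \<and> U.span T = UNIV" using S(1) by (intro exI[of _ ?T]) auto
  have comm: "unit_mult u v = unit_mult v u" for u v
    by (simp add: unit_mult_def mult_commute c_commute algebra_simps)
  have lin: "Vector_Spaces.linear unit_scale unit_scale (unit_mult u)" for u
    unfolding Vector_Spaces.linear_iff
    by (auto intro: vs simp: unit_mult_def unit_scale_def mult_add_right mult_scale_right c_linear
      scale_left_distrib scale_right_distrib algebra_simps)
  have lin': "Vector_Spaces.linear unit_scale unit_scale (\<lambda>u. unit_mult u v)" for v
    using lin[of v] comm by (metis (no_types, lifting) ext)
  have assoc: "x \<odot> (y \<odot> z) = (x \<odot> y) \<odot> z - c y z \<cdot> x + c x y \<cdot> z" for x y z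
    using form by (auto simp: associator_form_def associator_def algebra_simps)
  have "unit_mult (unit_mult u v) w = unit_mult u (unit_mult v w)" for u v w
    by (simp add: unit_mult_def assoc mult_add_right mult_add_left mult_scale_right mult_scale_left
      c_linear associator_form_invariant[OF form dim_ge_2]
      scale_left_distrib scale_right_distrib algebra_simps)
  then show "fd_comm_assoc_algebra unit_scale unit_mult"
    using vs fin comm lin lin' by unfold_locales (auto simp: bilinear_on_def)
qed

text \<open>Let \<open>v = (x, a)\<close> span an ideal and have square zero. The first components of \<open>(y, 0) v\<close> say that
  \<open>y \<odot> x + a \<cdot> y = \<phi> y \<cdot> x\<close> with a linear functional \<open>\<phi>\<close>, so multiplication by \<open>x\<close> is the sum of
  \<open>- a\<close> times the identity and an operator of rank one. Its trace \<open>\<phi> x - n a\<close> vanishes by exactness, and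
  \<open>\<phi> x = - a\<close> because \<open>v\<close> squares to zero; hence \<open>a = 0\<close>. Then the second components
  say that \<open>c x\<close> vanishes identically.\<close>
lemma unitization_reduced:
  assumes v: "v \<noteq> 0" and line: "\<forall>u. \<exists>t. unit_mult u v = unit_scale t v"
  shows "unit_mult v v \<noteq> 0"
proof
  assume sq: "unit_mult v v = 0"
  obtain x a where xa: "v = (x, a)" by (cases v)
  have sq': "x \<odot> x + a \<cdot> x + a \<cdot> x = 0" "c x x + a * a = 0"
    using sq by (auto simp: xa unit_mult_def zero_prod_def)
  have "x \<noteq> 0" using sq'(2) v by (auto simp: xa zero_prod_def)
  have "\<exists>t. y \<odot> x + a \<cdot> y = t \<cdot> x \<and> c y x = t * a" for y
    using line[rule_format, of "(y, 0)"] by (auto simp: xa unit_mult_def unit_scale_def)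
  then obtain \<phi> where \<phi>: "\<And>y. y \<odot> x + a \<cdot> y = \<phi> y \<cdot> x" and c\<phi>: "\<And>y. c y x = \<phi> y * a"
    by metis
  have uniq: "\<phi> y = t" if "y \<odot> x + a \<cdot> y = t \<cdot> x" for y t
    using that \<phi>[of y] \<open>x \<noteq> 0\<close> by simp
  have lin: "Vector_Spaces.linear scale (*) \<phi>"
    unfolding Vector_Spaces.linear_iff
  proof (intro conjI allI vector_space_axioms vector_space_over_itself.vector_space_axioms uniq)
    show "(y + z) \<odot> x + a \<cdot> (y + z) = (\<phi> y + \<phi> z) \<cdot> x" for y z
      using \<phi>[of y] \<phi>[of z]
      by (simp add: mult_add_left scale_right_distrib scale_left_distrib algebra_simps)
    show "(t \<cdot> y) \<odot> x + a \<cdot> (t \<cdot> y) = (t * \<phi> y) \<cdot> x" for t y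
    proof -
      have "(t \<cdot> y) \<odot> x + a \<cdot> (t \<cdot> y) = t \<cdot> (y \<odot> x + a \<cdot> y)"
        by (simp add: mult_scale_left scale_right_distrib mult.commute)
      then show ?thesis by (simp add: \<phi>)
    qed
  qed
  have "\<phi> x = - a"
    by (rule uniq) (use sq'(1) in \<open>simp add: eq_neg_iff_add_eq_0\<close>)
  have "x \<odot> y = \<phi> y \<cdot> x - a \<cdot> y" for y
    using \<phi>[of y] by (simp add: mult_commute[of x] algebra_simps)
  then have "trace (\<lambda>y. x \<odot> y) = trace (\<lambda>y. \<phi> y \<cdot> x - a \<cdot> y)" by simp
  then have "\<phi> x - a * of_nat (dim UNIV) = 0"
    using exact by (simp add: exact_def trace_diff trace_scale trace_id trace_rank_one[OF lin])
  then have "a * of_nat (Suc (dim UNIV)) = 0"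
    using \<open>\<phi> x = - a\<close> by (metis add.right_inverse diff_eq_eq add_0 distrib_left mult.right_neutral of_nat_Suc)
  then have "a = 0" by (simp only: mult_eq_0_iff of_nat_eq_0_iff) simp
  then have "c x y = 0" for y using c\<phi>[of y] c_commute by simp
  then show False using nondegenerate \<open>x \<noteq> 0\<close> by blast
qed

context
  fixes E :: "('a \<times> 'k) set" and e0 :: "'a \<times> 'k" and F :: "('a \<times> 'k) set"
  assumes indE: "unitization.independent E" and spanE: "unitization.span E = UNIV"
    and orth: "unitization.orthogonal_idempotents E" and e0: "e0 \<in> E"
  defines "F \<equiv> E - {e0}"
begin

lemma finite_E: "finite E"
  by (rule unitization.finite_independent[OF indE])

lemma E_eq: "E = insert e0 F" and e0_notin_F: "e0 \<notin> F" and finite_F: "finite F"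
  using e0 finite_E by (auto simp: F_def)

lemma mult_unit: "unit_mult u (0, t) = unit_scale t u"
  by (simp add: unit_mult_def unit_scale_def mult.commute)

lemma idempotent_nonzero: "e \<in> E \<Longrightarrow> e \<noteq> 0"
  using indE unitization.dependent_zero by blast

lemma fst_combination: "fst (\<Sum>e\<in>S. unit_scale (w e) e) = (\<Sum>e\<in>S. w e \<cdot> fst e)"
  by (simp add: fst_sum unit_scale_def)

text \<open>The kernel of \<open>fst\<close> is the line of the unit, and no multiple of the unit but \<open>0\<close> is annihilated
  by \<open>e0\<close>, whereas the span of the other idempotents is. So \<open>fst\<close> is injective on that span.\<close>
lemma inj_on_fst: "inj_on fst F"
proof (rule inj_onI)
  fix e f assume ef: "e \<in> F" "f \<in> F" "fst e = fst f"
  then have eq: "e - f = (0, snd e - snd f)" by (simp add: prod_eq_iff)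
  have "unit_mult e0 (e - f) = 0"
    using ef orth e0
    by (auto simp: F_def unitization.mult_diff_right unitization.orthogonal_idempotents_def)
  then have "snd e - snd f = 0" using idempotent_nonzero[OF e0] by (simp add: eq mult_unit)
  then show "e = f" using ef(3) by (simp add: prod_eq_iff)
qed

lemma independent_fst: "independent (fst ` F)"
proof (rule independent_if_scalars_zero)
  show "finite (fst ` F)" using finite_F by simp
  fix w x assume w: "(\<Sum>x\<in>fst ` F. w x \<cdot> x) = 0" and x: "x \<in> fst ` F"
  then obtain f where f: "f \<in> F" "x = fst f" by blast
  define w' where "w' e = (if e = e0 then 0 else w (fst e))" for e
  define v where "v = (\<Sum>e\<in>E. unit_scale (w' e) e)"
  have "v = (\<Sum>e\<in>F. unit_scale (w (fst e)) e)"
    unfolding v_def E_eq using finite_F e0_notin_F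
    by (simp add: w'_def) (intro sum.cong, auto)
  then have "fst v = (\<Sum>e\<in>F. w (fst e) \<cdot> fst e)" by (simp add: fst_combination)
  also have "\<dots> = 0" using w by (simp add: sum.reindex[OF inj_on_fst])
  finally have v: "v = (0, snd v)" by (simp add: prod_eq_iff)
  have ev: "unit_scale (w' e) e = unit_scale (snd v) e" if "e \<in> E" for e
    using unitization.mult_orthogonal_idempotents_sum[OF orth finite_E that, of w'] v mult_unit
    unfolding v_def[symmetric] by metis
  have "snd v = 0" using ev[OF e0] idempotent_nonzero[OF e0] by (simp add: w'_def)
  moreover have "f \<in> E" "f \<noteq> e0" using f by (auto simp: F_def)
  ultimately have "w' f = 0" using ev[of f] idempotent_nonzero[of f] by auto
  then show "w x = 0" using f \<open>f \<noteq> e0\<close> by (simp add: w'_def)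
qed

lemma sum_idempotents: "(\<Sum>e\<in>E. e) = (0, 1)"
proof -
  let ?t = "unitization.representation E (0, 1)"
  have eq: "(\<Sum>e\<in>E. unit_scale (?t e) e) = (0, 1)"
    by (rule unitization.sum_coordinates[OF indE spanE])
  have "unit_scale (?t e) e = e" if "e \<in> E" for e
    using unitization.mult_orthogonal_idempotents_sum[OF orth finite_E that, of ?t]
    unfolding eq mult_unit by simp
  then have "(\<Sum>e\<in>E. e) = (\<Sum>e\<in>E. unit_scale (?t e) e)" by (intro sum.cong) auto
  then show ?thesis by (simp only: eq)
qed

lemma span_fst: "span (fst ` F) = UNIV"
proof -
  have F_span: "fst e \<in> span (fst ` F)" if "e \<in> F" for e using that by (intro span_base) simp
  have "fst e0 + (\<Sum>e\<in>F. fst e) = 0"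
    using arg_cong[OF sum_idempotents, of fst] finite_F e0_notin_F by (simp add: E_eq fst_sum)
  then have "fst e0 = - (\<Sum>e\<in>F. fst e)" by (simp add: eq_neg_iff_add_eq_0)
  then have "fst e0 \<in> span (fst ` F)" by (simp add: span_neg span_sum F_span)
  then have E_span: "fst e \<in> span (fst ` F)" if "e \<in> E" for e using that E_eq F_span by blast
  have "y \<in> span (fst ` F)" for y
  proof -
    have "y = fst (\<Sum>e\<in>E. unit_scale (unitization.representation E (y, 0) e) e)"
      by (simp add: unitization.sum_coordinates[OF indE spanE])
    also have "\<dots> \<in> span (fst ` F)"
      unfolding fst_combination by (intro span_sum span_scale E_span)
    finally show ?thesis .
  qed
  then show ?thesis by blast
qed

lemma card_F: "card F = dim UNIV"
  using card_eq_dim_UNIV[OF independent_fst span_fst] by (simp add: card_image[OF inj_on_fst])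

lemma fst_mult_fst:
  assumes "e \<in> F" "f \<in> F"
  shows "fst e \<odot> fst f = (if e = f then (1 - snd e - snd e) \<cdot> fst e
    else - snd e \<cdot> fst f - snd f \<cdot> fst e)"
proof -
  have move: "x = y - p - q" if "x + p + q = y" for x y p q :: 'a
    using that[symmetric] by simp
  have "unit_mult e f = (if e = f then e else 0)"
    using orth assms by (auto simp: F_def unitization.orthogonal_idempotents_def)
  then have "fst e \<odot> fst f + snd e \<cdot> fst f + snd f \<cdot> fst e = (if e = f then fst e else 0)"
    by (simp add: unit_mult_def prod_eq_iff split: if_splits)
  then have "fst e \<odot> fst f = (if e = f then fst e else 0) - snd e \<cdot> fst f - snd f \<cdot> fst e"
    by (rule move)
  then show ?thesis
    by (cases "e = f")
      (simp_all only: scale_left_diff_distrib scale_one if_True if_False simp_thms diff_0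
        scale_minus_left)
qed

text \<open>In the basis \<open>fst ` F\<close>, the diagonal entries of multiplication by \<open>fst e\<close> are \<open>1 - 2 * snd e\<close> once
  and \<open>- snd e\<close> in the remaining \<open>n - 1\<close> places. Exactness makes their sum zero.\<close>
lemma snd_idempotent:
  assumes e: "e \<in> F"
  shows "snd e = 1 / (of_nat (dim UNIV) + 1)"
proof -
  let ?B = "fst ` F"
  have "0 = trace (\<lambda>y. fst e \<odot> y)" using exact by (simp add: exact_def)
  also have "\<dots> = (\<Sum>b\<in>?B. representation ?B (fst e \<odot> b) b)"
    by (rule trace_eq[OF finite_dim independent_fst span_fst linear_mult_left])
  also have "\<dots> = (\<Sum>f\<in>F. representation ?B (fst e \<odot> fst f) (fst f))"
    by (simp add: sum.reindex[OF inj_on_fst])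
  also have "\<dots> = (\<Sum>f\<in>F. - snd e + (if e = f then 1 - snd e else 0))"
  proof (intro sum.cong refl)
    fix f assume f: "f \<in> F"
    have "fst e = fst f \<longleftrightarrow> e = f" using inj_on_eq_iff[OF inj_on_fst e f] .
    then show "representation ?B (fst e \<odot> fst f) (fst f) =
        - snd e + (if e = f then 1 - snd e else 0)"
      using e f by (auto simp: fst_mult_fst representation_scale representation_diff
        representation_neg representation_basis independent_fst span_fst)
  qed
  also have "\<dots> = 1 - (of_nat (dim UNIV) + 1) * snd e"
    unfolding sum.distrib using e finite_F by (simp add: card_F algebra_simps)
  finally have eq: "(of_nat (dim UNIV) + 1) * snd e = 1" by simp
  then have "of_nat (dim UNIV) + 1 \<noteq> (0::'k)" by auto
  then show ?thesis using eq by (simp add: eq_divide_eq mult.commute)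
qed

lemma simplicial_frame_from_idempotents: "\<exists>B. simplicial_frame B"
proof -
  define n :: 'k where "n = of_nat (dim UNIV)"
  \<comment> \<open>the inverse of \<open>1 - 2 / (n + 1)\<close>, the factor in \<open>fst e \<odot> fst e\<close>\<close>
  define k where "k = (n + 1) / (n - 1)"
  have "of_nat (dim UNIV + 1) \<noteq> (0::'k)" unfolding of_nat_eq_0_iff by simp
  then have n1: "n + 1 \<noteq> 0" by (simp add: n_def add.commute)
  have "of_nat (dim UNIV - 1) \<noteq> (0::'k)" unfolding of_nat_eq_0_iff using dim_ge_2 by simp
  then have n2: "n - 1 \<noteq> 0" using dim_ge_2 by (simp add: n_def of_nat_diff)
  have card: "of_nat (card (fst ` F)) = n" by (simp add: card_image[OF inj_on_fst] card_F n_def)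
  have inv_k: "inverse k = (n - 1) / (n + 1)" by (simp add: k_def)
  have "1 - 1 / (n + 1) - 1 / (n + 1) = ((n + 1) - 1 - 1) / (n + 1)"
    by (simp only: diff_divide_distrib divide_self[OF n1])
  then have k: "1 - 1 / (n + 1) - 1 / (n + 1) = inverse k" "1 / (n + 1) = inverse k / (n - 1)"
    using n2 by (simp_all add: inv_k)
  have "simplicial_frame ((\<lambda>b. k \<cdot> b) ` fst ` F)"
  proof (rule simplicial_frame_rescale[OF independent_fst span_fst])
    show "k \<noteq> 0" using n1 n2 by (simp add: k_def)
    fix b c assume "b \<in> fst ` F" "c \<in> fst ` F"
    then obtain e f where ef: "e \<in> F" "f \<in> F" "b = fst e" "c = fst f" by blast
    have iff: "b = c \<longleftrightarrow> e = f" using inj_on_eq_iff[OF inj_on_fst ef(1,2)] ef(3,4) by simp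
    have "b \<odot> c = (if b = c then (1 - 1 / (n + 1) - 1 / (n + 1)) \<cdot> b
        else - (1 / (n + 1)) \<cdot> c - (1 / (n + 1)) \<cdot> b)"
      unfolding iff unfolding ef(3,4) fst_mult_fst[OF ef(1,2)]
      by (simp only: snd_idempotent ef(1,2) n_def)
    then have "b \<odot> c = (if b = c then inverse k \<cdot> b
        else - (inverse k / (n - 1)) \<cdot> c - (inverse k / (n - 1)) \<cdot> b)"
      unfolding k(1) unfolding k(2) .
    then show "b \<odot> c = (if b = c then inverse k \<cdot> b
        else - (inverse k / (of_nat (card (fst ` F)) - 1)) \<cdot> (b + c))"
      unfolding card by (simp add: scale_right_distrib)
  qed
  then show ?thesis by blast
qed

end

lemma ex_simplicial_frame:
  assumes eigen: "\<And>I u. unitization.is_ideal I \<Longrightarrow> I \<noteq> {0} \<Longrightarrow>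
    \<exists>v\<in>I. v \<noteq> 0 \<and> (\<exists>t. unit_mult u v = unit_scale t v)"
  shows "\<exists>B. simplicial_frame B"
proof -
  obtain E where E: "unitization.independent E" "unitization.span E = UNIV"
    "unitization.orthogonal_idempotents E"
    using unitization.orthogonal_idempotent_basis[OF eigen unitization_reduced] by blast
  have "E \<noteq> {}"
  proof
    assume "E = {}"
    then have "(0, 1) \<in> unitization.span {}" using E(2) by auto
    then show False by (simp add: zero_prod_def)
  qed
  then show ?thesis using simplicial_frame_from_idempotents[OF E] by blast
qed

end

lemma ex_simplicial_frame_alg_closed:
  fixes s :: "'k::{field_char_0, alg_closed_field} \<Rightarrow> 'a::ab_group_add \<Rightarrow> 'a"
  assumes "associator_form_algebra s m c"
  shows "\<exists>B. fd_algebra.simplicial_frame s m B"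
proof -
  interpret associator_form_algebra s m c by fact
  obtain D where D: "finite_dimensional_vector_space unit_scale D"
    using unitization.finite_dimensional by blast
  show ?thesis
  proof (rule ex_simplicial_frame)
    fix I u assume I: "unitization.is_ideal I" "I \<noteq> {0}"
    have sub: "unitization.subspace I" and closed: "\<And>v. v \<in> I \<Longrightarrow> unit_mult u v \<in> I"
      using I(1) unfolding unitization.is_ideal_def by blast+
    show "\<exists>v\<in>I. v \<noteq> 0 \<and> (\<exists>t. unit_mult u v = unit_scale t v)"
      by (rule eigenvector_alg_closed[OF D unitization.linear_mult_left sub closed I(2)])
  qed
qed

text \<open>The scalar component of the product is a symmetric form on the unitization,
  \<open>c x y + a b\<close> at \<open>(x, a)\<close>, \<open>(y, b)\<close>. It is positive definite, and associativity makes
  multiplication operators self-adjoint for it, so they have real eigenvalues.\<close>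
lemma ex_simplicial_frame_real:
  fixes s :: "real \<Rightarrow> 'a::ab_group_add \<Rightarrow> 'a"
  assumes "associator_form_algebra s m c" and pos: "\<And>x. x \<noteq> 0 \<Longrightarrow> c x x > 0"
  shows "\<exists>B. fd_algebra.simplicial_frame s m B"
proof -
  interpret associator_form_algebra s m c by fact
  obtain D where D: "finite_dimensional_vector_space unit_scale D"
    using unitization.finite_dimensional by blast
  define h where "h u v = snd (unit_mult u v)" for u v
  have h_bilinear: "bilinear_on unit_scale (*) h"
    unfolding bilinear_on_def Vector_Spaces.linear_iff
    by (auto intro: unitization.vector_space_axioms vector_space_over_itself.vector_space_axioms
      simp: h_def unitization.mult_add_left unitization.mult_add_right
        unitization.mult_scale_left unitization.mult_scale_right) (auto simp: unit_scale_def)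
  have h_pos: "h u u > 0" if "u \<noteq> 0" for u
  proof -
    have "c x x \<ge> 0" for x using pos[of x] by (cases "x = 0") auto
    moreover have "fst u \<noteq> 0 \<or> snd u \<noteq> 0" using that by (auto simp: prod_eq_iff)
    ultimately show ?thesis
      using pos[of "fst u"] zero_le_square[of "snd u"]
      by (auto simp: h_def unit_mult_def add_pos_nonneg add_nonneg_pos zero_less_mult_iff linorder_neq_iff)
  qed
  have h_self_adjoint: "h (unit_mult u v) w = h v (unit_mult u w)" for u v w
    by (metis h_def unitization.mult_assoc unitization.mult_commute)
  show ?thesis
  proof (rule ex_simplicial_frame)
    fix I u assume I: "unitization.is_ideal I" "I \<noteq> {0}"
    have sub: "unitization.subspace I" and closed: "\<And>v. v \<in> I \<Longrightarrow> unit_mult u v \<in> I"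
      using I(1) unfolding unitization.is_ideal_def by blast+
    show "\<exists>v\<in>I. v \<noteq> 0 \<and> (\<exists>t. unit_mult u v = unit_scale t v)"
      by (rule eigenvector_real_self_adjoint[OF D unitization.linear_mult_left
          h_bilinear h_pos h_self_adjoint sub closed I(2)])
  qed
qed

section \<open>Characterization of the simplicial algebra\<close>

lemma simplicial_frame_properties:
  fixes s :: "'k::field_char_0 \<Rightarrow> 'a::ab_group_add \<Rightarrow> 'a"
  assumes "fd_comm_algebra s m" "fd_algebra.simplicial_frame s m B"
    and dim: "vector_space.dim s UNIV \<ge> 2"
  shows "framed_algebra s m B"
    and "fd_algebra.exact s m" "fd_algebra.projectively_associative s m"
    and "fd_algebra.nondegenerate_killing s m"
    and "fd_algebra.killing s m x y =
      (of_nat (vector_space.dim s UNIV) - 1) * framed_algebra.frame_form s B x y"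
proof -
  interpret A: fd_comm_algebra s m by fact
  have card: "card B = A.dim UNIV"
    using assms(2) by (auto simp: A.simplicial_frame_def intro: A.card_eq_dim_UNIV)
  show F: "framed_algebra s m B"
    using assms card by unfold_locales auto
  interpret F: framed_algebra s m B "- (1 / (of_nat (card B) - 1))" by fact simp
  show "A.exact" "A.projectively_associative"
    by (fact F.exact, fact F.projectively_associative)
  have "A.associator_form F.frame_form"
    unfolding A.associator_form_def
    using F.bilinear_frame_form F.frame_form_commute F.associator_frame_form by blast
  then have killing: "A.killing x y = (of_nat (A.dim UNIV) - 1) * F.frame_form x y" for x y
    by (rule A.killing_eq_associator_form[OF F.exact])
  then show "A.killing x y = (of_nat (A.dim UNIV) - 1) * F.frame_form x y" .
  show "A.nondegenerate_killing"
    unfolding A.nondegenerate_killing_def killing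
    using F.frame_form_nondegenerate F.card_minus_one_ne_0 by (simp add: card)
qed

lemma ex_associator_form:
  fixes s :: "'k::field_char_0 \<Rightarrow> 'a::ab_group_add \<Rightarrow> 'a"
  assumes "fd_comm_algebra s m" and dim: "vector_space.dim s UNIV \<ge> 2"
    and "fd_algebra.exact s m" "fd_algebra.nondegenerate_killing s m"
    and "fd_algebra.projectively_associative s m"
  shows "\<exists>c. associator_form_algebra s m c \<and>
    (\<forall>x y. fd_algebra.killing s m x y = (of_nat (vector_space.dim s UNIV) - 1) * c x y)"
proof -
  interpret A: fd_comm_algebra s m by fact
  obtain c where c: "A.associator_form c"
    using assms(5) unfolding A.projectively_associative_def A.associator_form_def by blast
  note killing = A.killing_eq_associator_form[OF assms(3) c]
  have "associator_form_algebra s m c"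
    using c dim assms(3,4)
    by unfold_locales (auto simp: A.nondegenerate_killing_def killing)
  then show ?thesis using killing by blast
qed

lemma nondegenerate_if_pos_def_killing:
  assumes "fd_algebra s m" "pos_def_killing s m"
  shows "fd_algebra.nondegenerate_killing s m"
  using assms(2) unfolding fd_algebra.nondegenerate_killing_def[OF assms(1)] pos_def_killing_def
  by (metis less_irrefl)

theorem theorem6p8:
  fixes n :: nat
    and scale :: "'k::{field_char_0, alg_closed_field} \<Rightarrow> 'a::ab_group_add \<Rightarrow> 'a"
    and mult :: "'a \<Rightarrow> 'a \<Rightarrow> 'a"
    and scaleR' :: "real \<Rightarrow> 'b::ab_group_add \<Rightarrow> 'b"
    and mult' :: "'b \<Rightarrow> 'b \<Rightarrow> 'b"
  assumes "n \<ge> 2" and "CARD('n::finite) = n"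
  shows
    "(fd_comm_algebra scale mult \<and> vector_space.dim scale UNIV = n \<longrightarrow>
       (algebra_isomorphic scale mult
          (simp_scale :: 'k \<Rightarrow> ('k, 'n) simplicial \<Rightarrow> ('k, 'n) simplicial) simp_times
        \<longleftrightarrow> fd_algebra.exact scale mult
            \<and> fd_algebra.nondegenerate_killing scale mult
            \<and> fd_algebra.projectively_associative scale mult))
     \<and>
     (fd_comm_algebra scaleR' mult' \<and> vector_space.dim scaleR' UNIV = n \<longrightarrow>
       (algebra_isomorphic scaleR' mult'
          (simp_scale :: real \<Rightarrow> (real, 'n) simplicial \<Rightarrow> (real, 'n) simplicial) simp_times
        \<longleftrightarrow> fd_algebra.exact scaleR' mult'
            \<and> pos_def_killing scaleR' mult'
            \<and> fd_algebra.projectively_associative scaleR' mult'))"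
proof (intro conjI impI; elim conjE)
  have n: "CARD('n) \<ge> 2" using assms by simp
  assume A: "fd_comm_algebra scale mult" and dim: "vector_space.dim scale UNIV = n"
  have dim2: "vector_space.dim scale UNIV \<ge> 2" using assms dim by simp
  have dimn: "vector_space.dim scale UNIV = CARD('n)" using assms dim by simp
  have alg: "fd_algebra scale mult" by (rule fd_comm_algebra.axioms(1)[OF A])
  show "algebra_isomorphic scale mult
      (simp_scale :: 'k \<Rightarrow> ('k, 'n) simplicial \<Rightarrow> ('k, 'n) simplicial) simp_times
    \<longleftrightarrow> fd_algebra.exact scale mult \<and> fd_algebra.nondegenerate_killing scale mult
      \<and> fd_algebra.projectively_associative scale mult"
    unfolding algebra_isomorphic_simplicial_iff[OF alg dimn n]
    using simplicial_frame_properties(2-4)[OF A _ dim2] ex_associator_form[OF A dim2]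
      ex_simplicial_frame_alg_closed[of scale mult] by meson
next
  have n: "CARD('n) \<ge> 2" using assms by simp
  assume A: "fd_comm_algebra scaleR' mult'" and dim: "vector_space.dim scaleR' UNIV = n"
  have dim2: "vector_space.dim scaleR' UNIV \<ge> 2" using assms dim by simp
  have dimn: "vector_space.dim scaleR' UNIV = CARD('n)" using assms dim by simp
  have pos: "real (vector_space.dim scaleR' UNIV) - 1 > 0" using dim2 by simp
  have alg: "fd_algebra scaleR' mult'" by (rule fd_comm_algebra.axioms(1)[OF A])
  have "fd_algebra.exact scaleR' mult' \<and> pos_def_killing scaleR' mult' \<and>
    fd_algebra.projectively_associative scaleR' mult'"
    if B: "fd_algebra.simplicial_frame scaleR' mult' B" for B
  proof -
    note props = simplicial_frame_properties[OF A B dim2]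
    have "pos_def_killing scaleR' mult'"
      unfolding pos_def_killing_def props(5)
      using frame_form_positive[OF props(1)] pos by simp
    then show ?thesis using props(2,3) by blast
  qed
  moreover have "\<exists>B. fd_algebra.simplicial_frame scaleR' mult' B"
    if conds: "fd_algebra.exact scaleR' mult'" "pos_def_killing scaleR' mult'"
      "fd_algebra.projectively_associative scaleR' mult'"
  proof -
    obtain c where c: "associator_form_algebra scaleR' mult' c"
      and killing: "\<And>x y. fd_algebra.killing scaleR' mult' x y =
        (real (vector_space.dim scaleR' UNIV) - 1) * c x y"
      using ex_associator_form[OF A dim2 conds(1) nondegenerate_if_pos_def_killing[OF alg conds(2)]
        conds(3)] by blast
    have "c x x > 0" if "x \<noteq> 0" for x
      using conds(2) that pos
      by (auto simp: pos_def_killing_def killing zero_less_mult_iff)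
    then show ?thesis by (rule ex_simplicial_frame_real[OF c])
  qed
  ultimately show "algebra_isomorphic scaleR' mult'
      (simp_scale :: real \<Rightarrow> (real, 'n) simplicial \<Rightarrow> (real, 'n) simplicial) simp_times
    \<longleftrightarrow> fd_algebra.exact scaleR' mult' \<and> pos_def_killing scaleR' mult'
      \<and> fd_algebra.projectively_associative scaleR' mult'"
    unfolding algebra_isomorphic_simplicial_iff[OF alg dimn n] by blast
qed

end
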